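(* Let $T>0$, $\lambda>0$, $K>0$, and let $f$ be a probability density on $(0,+\infty)$ with cumulative distribution function $F$ (so $F(0)=0$), such that $f(p)>0$ for all $p>0$ and $\lim_{p\to+\infty}p^3f(p)=0$. For $(t,S)\in[0,T]\times\mathbb{R}$ let $$\tilde v(t,S)=\inf_{(\tilde b_s)_{s\in[t,T]}}\left\{-\lambda\int_t^T F(\tilde b_s)\,ds+K\min\left(\tilde S^{\tilde b,t,S}_T,0\right)^2\right\},$$ where the infimum is over deterministic measurable controls $\tilde b:[t,T]\to\mathbb{R}_+\cup\{+\infty\}$ and $$d\tilde S^{\tilde b,t,S}_s=-\lambda G(\tilde b_s)\,ds,\qquad \tilde S^{\tilde b,t,S}_t=S,\qquad G(x)=\int_0^x p f(p)\,dp\quad (x\in\mathbb{R}_+\cup\{+\infty\}).$$ Define, for $x\in\mathbb{R}$, $$H(x)=\lambda\sup_{b\in\mathbb{R}_+}\int_0^b f(p)(1+xp)\,dp=\begin{cases}-\lambda x\int_0^{-1/x}F(p)\,dp, & x<0,\\ \lambda\left(1+x\int_0^\infty p f(p)\,dp\right), & x\ge 0.\end{cases}$$ Then the value function is given by $$\tilde v(t,S)=\sup_{x\le 0}\left(Sx-(T-t)H(x)-\frac{x^2}{4K}\right).$$ It is the unique weak semi-concave solution of the Hamilton-Jacobi equation $$-\partial_t v(t,S)-\lambda\inf_{b\in\mathbb{R}_+}\left(-\int_0^b f(p)\left(1+p\,\partial_S v(t,S)\right)dp\right)=0,\qquad v(T,S)=K\min(S,0)^2.$$ Furthermore, the optimal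 control function $(t,S)\mapsto\tilde b^*(t,S)$ is given by the following: (i) if $S\ge\lambda(T-t)\int_0^\infty p f(p)\,dp$, then $\tilde b^*(t,S)=+\infty$; (ii) if $S<\lambda(T-t)\int_0^\infty p f(p)\,dp$, then $\tilde b^*(t,S)=-\frac{1}{x^*}$, where $x^*$ is characterized by $$S=(T-t)H'(x^* )+\frac{x^*}{2K}.$$
   Context: Conventions: $F(+\infty)=1$ and $G(+\infty)=\int_0^\infty p f(p)\,dp$, which is finite under the assumptions on $f$. The optimal control function is the feedback (closed-loop) form of the optimal control: a function $\tilde b^*$ of (time, current remaining cash) such that, for every starting point $(t,S)$, the control $\tilde b_s=\tilde b^*(s,\tilde S_s)$, with $\tilde S$ the corresponding state trajectory started from $S$ at time $t$, attains the infimum defining $\tilde v(t,S)$. Weak semi-concave solution (standard notion for first-order Hamilton-Jacobi equations with convex Hamiltonian, written here with a terminal condition): a locally Lipschitz function $v$ on $[0,T]\times\mathbb{R}$ that satisfies the terminal condition, satisfies the equation at almost every $(t,S)$, and is semi-concave in $S$, i.e. there is a constant $C\ge 0$ such that $v(t,S+z)-2v(t,S)+v(t,S-z)\le C\left(1+\frac{1}{T-t}\right)z^2$ for all $t\in[0,T)$ and $S,z\in\mathbb{R}$. *)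

theory Defs
  imports "HOL-Analysis.Analysis"
begin

text \<open>
  The density \<open>f\<close> lives on \<open>(0, \<infinity>)\<close>; its values at \<open>p \<le> 0\<close> are never used.
  The argument of \<open>F\<close> and \<open>G\<close> ranges over \<open>[0, \<infinity>]\<close>, which is the type \<^typ>\<open>ennreal\<close>:
  for \<open>x = ennreal b\<close> with \<open>b \<ge> 0\<close> the domain of integration is \<open>(0, b]\<close>, and for
  \<open>x = \<infinity>\<close> it is \<open>(0, \<infinity>)\<close>, so \<open>F \<infinity>\<close> is the total mass of \<open>f\<close> and \<open>G \<infinity>\<close> is its mean.
\<close>

definition F :: "(real \<Rightarrow> real) \<Rightarrow> ennreal \<Rightarrow> real" where
  "F f x = (LBINT p:{p. 0 < p \<and> ennreal p \<le> x}. f p)"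

definition G :: "(real \<Rightarrow> real) \<Rightarrow> ennreal \<Rightarrow> real" where
  "G f x = (LBINT p:{p. 0 < p \<and> ennreal p \<le> x}. p * f p)"

definition H :: "real \<Rightarrow> (real \<Rightarrow> real) \<Rightarrow> real \<Rightarrow> real" where
  "H lam f x = lam * (SUP b\<in>{0..}. LBINT p:{0<..b}. f p * (1 + x * p))"

definition controls :: "real \<Rightarrow> real \<Rightarrow> (real \<Rightarrow> ennreal) set" where
  "controls T t = borel_measurable (restrict_space borel {t..T})"

text \<open>The solution at time \<open>s\<close> of \<open>dS = - lam G(b) ds\<close> started from \<open>S\<close> at time \<open>t\<close>.\<close>

definition state :: "real \<Rightarrow> (real \<Rightarrow> real) \<Rightarrow> (real \<Rightarrow> ennreal) \<Rightarrow> real \<Rightarrow> real \<Rightarrow> real \<Rightarrow> real" where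
  "state lam f b t S s = S - lam * (LBINT u:{t..s}. G f (b u))"

definition cost ::
  "real \<Rightarrow> real \<Rightarrow> real \<Rightarrow> (real \<Rightarrow> real) \<Rightarrow> (real \<Rightarrow> ennreal) \<Rightarrow> real \<Rightarrow> real \<Rightarrow> real" where
  "cost T lam K f b t S =
     - lam * (LBINT s:{t..T}. F f (b s)) + K * (min (state lam f b t S T) 0)\<^sup>2"

definition value_fun ::
  "real \<Rightarrow> real \<Rightarrow> real \<Rightarrow> (real \<Rightarrow> real) \<Rightarrow> real \<Rightarrow> real \<Rightarrow> real" where
  "value_fun T lam K f t S = (INF b\<in>controls T t. cost T lam K f b t S)"

definition locally_lipschitz_on :: "'a::metric_space set \<Rightarrow> ('a \<Rightarrow> 'b::metric_space) \<Rightarrow> bool" where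
  "locally_lipschitz_on U u \<longleftrightarrow> (\<forall>z\<in>U. \<exists>e>0. \<exists>L. L-lipschitz_on (cball z e \<inter> U) u)"

definition weak_semiconcave_solution ::
  "real \<Rightarrow> real \<Rightarrow> real \<Rightarrow> (real \<Rightarrow> real) \<Rightarrow> (real \<Rightarrow> real \<Rightarrow> real) \<Rightarrow> bool" where
  "weak_semiconcave_solution T lam K f v \<longleftrightarrow>
     locally_lipschitz_on ({0..T} \<times> UNIV) (\<lambda>(t, S). v t S) \<and>
     (\<forall>S. v T S = K * (min S 0)\<^sup>2) \<and>
     (AE (t, S) in lborel. t \<in> {0<..<T} \<longrightarrow>
        (\<exists>vt vS. ((\<lambda>s. v s S) has_real_derivative vt) (at t) \<and>
                 ((\<lambda>y. v t y) has_real_derivative vS) (at S) \<and>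
                 - vt - lam * (INF b\<in>{0..}. - (LBINT p:{0<..b}. f p * (1 + p * vS))) = 0)) \<and>
     (\<exists>C\<ge>0. \<forall>t\<in>{0..<T}. \<forall>S z.
        v t (S + z) - 2 * v t S + v t (S - z) \<le> C * (1 + 1 / (T - t)) * z\<^sup>2)"

text \<open>
  \<open>X\<close> is a state trajectory on \<open>[t, T]\<close> started from \<open>S\<close> and driven by the feedback \<open>bs\<close>.
\<close>

definition closed_loop ::
  "real \<Rightarrow> real \<Rightarrow> (real \<Rightarrow> real) \<Rightarrow> (real \<Rightarrow> real \<Rightarrow> ennreal) \<Rightarrow> real \<Rightarrow> real \<Rightarrow> (real \<Rightarrow> real) \<Rightarrow> bool" where
  "closed_loop T lam f bs t S X \<longleftrightarrow>
     (\<lambda>s. bs s (X s)) \<in> controls T t \<and>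
     (\<forall>s\<in>{t..T}. X s = state lam f (\<lambda>u. bs u (X u)) t S s)"

definition optimal_control_function ::
  "real \<Rightarrow> real \<Rightarrow> real \<Rightarrow> (real \<Rightarrow> real) \<Rightarrow> (real \<Rightarrow> real \<Rightarrow> ennreal) \<Rightarrow> bool" where
  "optimal_control_function T lam K f bs \<longleftrightarrow>
     (\<forall>t\<in>{0..T}. \<forall>S.
        (\<exists>X. closed_loop T lam f bs t S X) \<and>
        (\<forall>X. closed_loop T lam f bs t S X \<longrightarrow>
           cost T lam K f (\<lambda>s. bs s (X s)) t S = value_fun T lam K f t S))"

end

theory Submission
  imports Defs
begin

text \<open>
  Let \<open>b(x) = -1/x\<close> for \<open>x < 0\<close> and \<open>b(x) = \<infinity>\<close> for \<open>x \<ge> 0\<close>.  Pointwise optimisation gives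
  \<open>H(x) = lam \<integral> max(0, 1 + x p) f(p) dp\<close>, attained at \<open>b(x)\<close>, and \<open>lam G(b(x))\<close> is a continuous
  subgradient of the convex function \<open>H\<close>, so \<open>H\<close> is continuously differentiable even where \<open>f\<close> is
  unbounded.

  Value function: Legendre duality for \<open>K min(s, 0)\<^sup>2\<close> bounds every cost from below by the concave dual
  functional at each \<open>x \<le> 0\<close>, and the constant control \<open>b(x)\<close> at the dual optimiser \<open>x\<close> attains the
  dual optimum.  The dual optimiser is Lipschitz in \<open>(t, S)\<close> and a subgradient of the convex value
  function, which is therefore differentiable; it is constant along the optimal trajectories.

  Uniqueness: where a semi-concave solution \<open>v\<close> has a derivative in \<open>S\<close> it is differentiable and solves
  the equation.  Integrating along straight lines of constant control gives \<open>v \<le> V\<close>.  Conversely, at a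
  maximum of \<open>V - v\<close> minus a penalty growing outside a cone of dependence, \<open>v\<close> is touched from below
  by a smooth function, hence differentiable in \<open>S\<close>, and the equation is contradicted there.  No second
  derivative of \<open>H\<close> is used.
\<close>

subsection \<open>Derivatives, Lipschitz and semi-concave functions\<close>

text \<open>The subgradient inequalities at \<open>x\<close> and at \<open>y\<close> trap the
  difference quotient between \<open>d x\<close> and \<open>d y\<close>, so continuity of
  \<open>d\<close> at \<open>x\<close> forces its limit.\<close>

lemma DERIV_of_subgradient:
  fixes \<phi> d :: "real \<Rightarrow> real"
  assumes "open U" "x \<in> U"
    and sub: "\<And>y z. y \<in> U \<Longrightarrow> z \<in> U \<Longrightarrow> \<phi> z \<ge> \<phi> y + d y * (z - y)"
    and cont: "isCont d x"
  shows "(\<phi> has_real_derivative d x) (at x)"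
proof -
  have "((\<lambda>y. (\<phi> y - \<phi> x) / (y - x) - d x) \<longlongrightarrow> 0) (at x)"
  proof (rule Lim_null_comparison[where g = "\<lambda>y. \<bar>d y - d x\<bar>"])
    show "((\<lambda>y. \<bar>d y - d x\<bar>) \<longlongrightarrow> 0) (at x)"
      using cont tendsto_rabs[OF LIM_zero[OF cont[unfolded isCont_def]]] by simp
    have "eventually (\<lambda>y. y \<in> U \<and> y \<noteq> x) (at x)"
      using assms(1,2) by (auto simp: eventually_at_topological)
    then show "\<forall>\<^sub>F y in at x. norm ((\<phi> y - \<phi> x) / (y - x) - d x) \<le> \<bar>d y - d x\<bar>"
    proof eventually_elim
      case (elim y)
      define q where "q = (\<phi> y - \<phi> x) / (y - x)"
      have q: "\<phi> y - \<phi> x = q * (y - x)" using elim by (simp add: q_def)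
      have "(q - d x) * (y - x) \<ge> 0" "(d y - q) * (y - x) \<ge> 0"
        using sub[of x y] sub[of y x] elim assms(2) q by (auto simp: algebra_simps)
      then have "\<bar>q - d x\<bar> \<le> \<bar>d y - d x\<bar>"
        using elim by (auto simp: zero_le_mult_iff)
      then show ?case by (simp add: q_def)
    qed
  qed
  then show ?thesis
    by (simp add: has_field_derivative_iff LIM_zero_cancel)
qed

lemma locally_lipschitz_on_compose:
  assumes u: "locally_lipschitz_on U u" and \<psi>: "L-lipschitz_on A \<psi>" "\<psi> ` A \<subseteq> U"
  shows "locally_lipschitz_on A (\<lambda>x. u (\<psi> x))"
  unfolding locally_lipschitz_on_def
proof
  fix z assume z: "z \<in> A"
  then obtain e L' where e: "e > 0" "L'-lipschitz_on (cball (\<psi> z) e \<inter> U) u"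
    using u \<psi>(2) unfolding locally_lipschitz_on_def by blast
  define d where "d = e / (L + 1)"
  have L: "L \<ge> 0" using \<psi>(1) by (rule lipschitz_on_nonneg)
  have d: "d > 0" using e(1) L by (simp add: d_def)
  have sub: "\<psi> ` (cball z d \<inter> A) \<subseteq> cball (\<psi> z) e \<inter> U"
  proof
    fix y assume "y \<in> \<psi> ` (cball z d \<inter> A)"
    then obtain x where x: "x \<in> A" "dist z x \<le> d" "y = \<psi> x" by auto
    have "dist (\<psi> z) (\<psi> x) \<le> L * dist z x" using \<psi>(1) z x(1) by (rule lipschitz_onD)
    also have "\<dots> \<le> L * d" using x L by (intro mult_left_mono) auto
    also have "\<dots> \<le> e" using L e(1) by (simp add: d_def field_simps)
    finally show "y \<in> cball (\<psi> z) e \<inter> U" using x \<psi>(2) by auto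
  qed
  have "(L' * L)-lipschitz_on (cball z d \<inter> A) (\<lambda>x. u (\<psi> x))"
    by (rule lipschitz_on_compose2) (auto intro: lipschitz_on_subset[OF \<psi>(1)] lipschitz_on_subset[OF e(2) sub])
  then show "\<exists>e>0. \<exists>L. L-lipschitz_on (cball z e \<inter> A) (\<lambda>x. u (\<psi> x))"
    using d by blast
qed

lemma locally_lipschitz_on_imp_continuous_on:
  assumes "locally_lipschitz_on U u"
  shows "continuous_on U u"
  unfolding continuous_on_eq_continuous_within
proof
  fix z assume z: "z \<in> U"
  then obtain e L where e: "e > 0" "L-lipschitz_on (cball z e \<inter> U) u"
    using assms unfolding locally_lipschitz_on_def by blast
  have "continuous (at z within (cball z e \<inter> U)) u"
    using lipschitz_on_continuous_within[OF e(2)] z e(1) by auto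
  moreover have "at z within (cball z e \<inter> U) = at z within U"
    using e(1) by (intro at_within_nhd[of _ "ball z e"]) auto
  ultimately show "continuous (at z within U) u" 
    by (simp add: continuous_within)
qed

text \<open>Truncating the difference quotients at \<open>c\<close> makes their limit the constant \<open>c\<close>, so that
  dominated convergence applies without knowing that the derivative is measurable.\<close>

lemma lipschitz_AE_deriv_ge:
  fixes g :: "real \<Rightarrow> real"
  assumes ab: "a \<le> b" and lip: "L-lipschitz_on {a..b} g"
    and ae: "AE t in lborel. t \<in> {a<..<b} \<longrightarrow> (\<exists>d\<ge>c. (g has_real_derivative d) (at t))"
  shows "c * (b - a) \<le> g b - g a"
proof -
  have L: "L \<ge> 0" using lip by (rule lipschitz_on_nonneg)
  \<comment> \<open>Constant continuation of \<open>g\<close> beyond \<open>{a..b}\<close>: it keeps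
    the Lipschitz constant and gives meaning to forward quotients near \<open>b\<close>.\<close>
  define G where "G t = g (max a (min b t))" for t
  have G_lip: "\<bar>G s - G t\<bar> \<le> L * \<bar>s - t\<bar>" for s t
  proof -
    have "\<bar>G s - G t\<bar> \<le> L * \<bar>max a (min b s) - max a (min b t)\<bar>"
      using lipschitz_onD[OF lip, of "max a (min b s)" "max a (min b t)"] ab
      by (auto simp: G_def dist_real_def)
    also have "\<dots> \<le> L * \<bar>s - t\<bar>" using L by (intro mult_left_mono) auto
    finally show ?thesis .
  qed
  have G_cont: "continuous_on X G" for X
    by (rule lipschitz_on_continuous_on[of L], rule lipschitz_onI)
       (use G_lip L in \<open>auto simp: dist_real_def\<close>)
  have [measurable]: "G \<in> borel_measurable borel"
    using G_cont by (rule borel_measurable_continuous_onI)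
  define h where "h n = 1 / real (Suc n)" for n
  have h: "h n > 0" for n by (simp add: h_def)
  have h0: "h \<longlonglongrightarrow> 0" unfolding h_def using LIMSEQ_inverse_real_of_nat by (simp add: inverse_eq_divide)
  define q where "q n t = (G (t + h n) - G t) / h n" for n t
  have q_bd: "\<bar>q n t\<bar> \<le> L" for n t
    using G_lip[of "t + h n" t] h[of n] by (simp add: q_def field_simps)
  have [measurable]: "q n \<in> borel_measurable borel" for n unfolding q_def by measurable
  have q_cont: "continuous_on X (q n)" for X n
    unfolding q_def using h[of n] by (intro continuous_intros continuous_on_compose2[OF G_cont[of UNIV]]) auto
  \<comment> \<open>The integral of a difference quotient is a difference of two averages: over
    \<open>{b..b + h n}\<close>, where \<open>G\<close> equals \<open>g b\<close>, and over
    \<open>{a..a + h n}\<close>, where it is within \<open>L * h n\<close> of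
    \<open>g a\<close>.\<close>
  have q_int: "(LBINT t:{a..b}. q n t) \<le> g b - g a + L * h n" for n
  proof -
    define \<Phi> where "\<Phi> x = integral {a..x} G" for x
    have ii: "G integrable_on {x..y}" for x y by (rule integrable_continuous_real[OF G_cont])
    have add: "integral {x..y} G + integral {y..z} G = integral {x..z} G" if "x \<le> y" "y \<le> z" for x y z
      using that ii by (intro Henstock_Kurzweil_Integration.integral_combine) auto
    have "(LBINT t:{a..b}. q n t) = integral {a..b} (q n)"
      by (rule set_borel_integral_eq_integral(2)[OF borel_integrable_atLeastAtMost']) (rule q_cont)
    also have "\<dots> = (integral {a..b} (\<lambda>t. G (t + h n)) - integral {a..b} G) / h n"
      unfolding q_def using ii
      by (subst Henstock_Kurzweil_Integration.integral_divide[symmetric] Henstock_Kurzweil_Integration.integral_diff[symmetric];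
          (intro integrable_continuous_real continuous_on_compose2[OF G_cont[of UNIV]] continuous_intros)?)+ auto
    also have "integral {a..b} (\<lambda>t. G (t + h n)) = integral {a + h n..b + h n} G"
      using integral_shift_Icc_real[of a b G "h n"] by (simp add: o_def add.commute)
    also have "integral {a + h n..b + h n} G - integral {a..b} G
       = integral {b..b + h n} G - integral {a..a + h n} G"
      using add[of a "a + h n" "b + h n"] add[of a b "b + h n"] ab h[of n] by simp
    also have "integral {b..b + h n} G = h n * g b"
    proof -
      have "integral {b..b + h n} G = integral {b..b + h n} (\<lambda>_. g b)"
        using ab by (intro Henstock_Kurzweil_Integration.integral_cong) (auto simp: G_def)
      then show ?thesis using h[of n] by simp
    qed
    also have "integral {a..a + h n} G \<ge> integral {a..a + h n} (\<lambda>_. g a - L * h n)"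
    proof (rule integral_le)
      fix t assume "t \<in> {a..a + h n}"
      moreover have "G a = g a" using ab by (simp add: G_def)
      moreover have "L * \<bar>t - a\<bar> \<le> L * h n" using \<open>t \<in> _\<close> L by (intro mult_left_mono) auto
      ultimately show "g a - L * h n \<le> G t" using G_lip[of t a] by linarith
    qed (auto intro: ii)
    then have "(h n * g b - integral {a..a + h n} G) / h n \<le> (h n * g b - h n * (g a - L * h n)) / h n"
      using h[of n] by (intro divide_right_mono) auto
    also have "\<dots> = g b - g a + L * h n" using h[of n] by (simp add: field_simps)
    finally show ?thesis by simp
  qed
  have lim: "(\<lambda>n. LINT t|lborel. indicator {a..b} t * min (q n t) c) \<longlonglongrightarrow> (LINT t|lborel. indicator {a..b} t * c)"
  proof (rule integral_dominated_convergence[where w = "\<lambda>t. indicator {a..b} t * (L + \<bar>c\<bar>)"])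
    show "integrable lborel (\<lambda>t. indicator {a..b} t * (L + \<bar>c\<bar>))"
      by (intro integrable_mult_left) (simp add: integrable_indicator_iff emeasure_lborel_Icc_eq)
    have "AE t in lborel. t \<noteq> a \<and> t \<noteq> b"
      using AE_lborel_singleton[of a] AE_lborel_singleton[of b] by (auto elim: AE_mp)
    then show "AE t in lborel. (\<lambda>n. indicator {a..b} t * min (q n t) c) \<longlonglongrightarrow> indicator {a..b} t * c"
      using ae
    proof eventually_elim
      case (elim t)
      show ?case
      proof (cases "t \<in> {a..b}")
        case True
        then have t: "t \<in> {a<..<b}" using elim by auto
        then obtain d where d: "d \<ge> c" "(g has_real_derivative d) (at t)" using elim by auto
        have "(G has_real_derivative d) (at t)"
          using d(2) by (rule has_field_derivative_transform_within_open[of _ _ _ "{a<..<b}"]) (use t in \<open>auto simp: G_def\<close>)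
        then have "((\<lambda>h. (G (t + h) - G t) / h) \<longlongrightarrow> d) (at 0)" by (simp add: DERIV_def)
        moreover have "filterlim h (at 0) sequentially"
          using h0 h by (auto simp: filterlim_at less_imp_neq[symmetric])
        ultimately have "(\<lambda>n. q n t) \<longlonglongrightarrow> d"
          unfolding q_def by (rule filterlim_compose)
        then have "(\<lambda>n. min (q n t) c) \<longlonglongrightarrow> min d c" by (intro tendsto_intros)
        then show ?thesis using True min_absorb2[OF d(1)] by simp
      qed simp
    qed
    show "AE t in lborel. norm (indicator {a..b} t * min (q n t) c) \<le> indicator {a..b} t * (L + \<bar>c\<bar>)" for n
    proof (intro AE_I2)
      fix t
      have "\<bar>min (q n t) c\<bar> \<le> L + \<bar>c\<bar>" using q_bd[of n t] by linarith
      then show "norm (indicator {a..b} t * min (q n t) c) \<le> indicator {a..b} t * (L + \<bar>c\<bar>)"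
        by (auto simp: indicator_def)
    qed
  qed (auto)
  have "(LINT t|lborel. indicator {a..b} t * min (q n t) c) \<le> g b - g a + L * h n" for n
  proof -
    have "(LINT t|lborel. indicator {a..b} t * min (q n t) c) \<le> (LINT t|lborel. indicator {a..b} t * q n t)"
    proof (rule integral_mono)
      show "integrable lborel (\<lambda>t. indicator {a..b} t * min (q n t) c)"
        using borel_integrable_compact[OF compact_Icc continuous_on_min[OF q_cont continuous_on_const]] by simp
      show "integrable lborel (\<lambda>t. indicator {a..b} t * q n t)"
        using borel_integrable_compact[of "{a..b}" "q n"] q_cont by (auto simp: set_integrable_def)
    qed (auto intro: mult_left_mono)
    then show ?thesis using q_int[of n] by (simp add: set_lebesgue_integral_def)
  qed
  moreover have "(\<lambda>n. g b - g a + L * h n) \<longlonglongrightarrow> g b - g a + L * 0"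
    by (intro tendsto_intros h0)
  ultimately have "(LINT t|lborel. indicator {a..b} t * c) \<le> g b - g a"
    using LIMSEQ_le[OF lim] by fastforce
  then show ?thesis using ab by (simp add: mult.commute)
qed

text \<open>The increment bound adds up over adjacent intervals and holds on intervals short enough
  for a single Lipschitz constant; Bolzano bisection extends it to \<open>{a..b}\<close>.\<close>

lemma locally_lipschitz_AE_deriv_ge:
  fixes g :: "real \<Rightarrow> real"
  assumes ab: "a \<le> b" and lip: "locally_lipschitz_on {a..b} g"
    and ae: "AE t in lborel. t \<in> {a<..<b} \<longrightarrow> (\<exists>d\<ge>c. (g has_real_derivative d) (at t))"
  shows "c * (b - a) \<le> g b - g a"
proof -
  have "a \<le> a \<longrightarrow> b \<le> b \<longrightarrow> c * (b - a) \<le> g b - g a"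
    using ab
  proof (induction rule: Bolzano[where P = "\<lambda>x y. a \<le> x \<longrightarrow> y \<le> b \<longrightarrow> c * (y - x) \<le> g y - g x"])
    case (trans x y z)
    then show ?case by (auto simp: algebra_simps)
  next
    case (local x)
    then obtain e L where e: "e > 0" "L-lipschitz_on (cball x e \<inter> {a..b}) g"
      using lip unfolding locally_lipschitz_on_def by (meson atLeastAtMost_iff)
    show ?case
    proof (intro exI[of _ e] conjI allI impI e(1))
      fix y z assume *: "y \<le> x \<and> x \<le> z \<and> z - y < e" "a \<le> y" "z \<le> b"
      show "c * (z - y) \<le> g z - g y"
      proof (rule lipschitz_AE_deriv_ge)
        show "L-lipschitz_on {y..z} g"
          using * by (intro lipschitz_on_subset[OF e(2)]) (auto simp: dist_real_def)
        show "AE t in lborel. t \<in> {y<..<z} \<longrightarrow> (\<exists>d\<ge>c. (g has_real_derivative d) (at t))"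
          using ae by eventually_elim (use * in auto)
      qed (use * in auto)
    qed
  qed
  then show ?thesis by simp
qed

text \<open>For fixed \<open>t\<close>, passing from \<open>y\<close> to \<open>y - c * t\<close> is
  a translation and respects null sets, so Fubini can be applied in either order. An equation valid
  almost everywhere in the plane thus holds at almost every time on almost every trajectory of speed
  \<open>c\<close>.\<close>

lemma AE_lborel_sheared_lines:
  fixes P :: "real \<Rightarrow> real \<Rightarrow> bool" and c :: real
  assumes "AE (t, S) in lborel. P t S"
  shows "AE y in lborel. AE t in lborel. P t (y - c * t)"
proof -
  \<comment> \<open>A measurable null set replaces the failure set of \<open>P\<close>, since
    exchanging the two quantifiers needs measurability.\<close>
  obtain N where N: "N \<in> null_sets lborel" "{z. \<not> (case z of (t, S) \<Rightarrow> P t S)} \<subseteq> N"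
    using assms by (auto elim!: AE_E simp: null_sets_def)
  have [measurable]: "N \<in> sets borel" using N(1) by (auto simp: null_sets_def)
  have "AE z in lborel \<Otimes>\<^sub>M (lborel :: real measure). z \<notin> N"
    using N(1) by (simp add: lborel_prod AE_not_in)
  then have "AE t in lborel. AE S in lborel. (t, S) \<notin> N"
    by (rule lborel_pair.AE_pair)
  then have "AE t in lborel. AE y in lborel. (t, y - c * t) \<notin> N"
  proof eventually_elim
    case (elim t)
    have "AE S in distr lborel borel ((+) (- c * t)). (t, S) \<notin> N"
      using elim by (subst lborel_distr_plus)
    then show ?case
      by (subst (asm) AE_distr_iff) (auto simp: algebra_simps)
  qed
  then have "AE y in lborel. AE t in lborel. (t, y - c * t) \<notin> N"
  proof (subst (asm) lborel_pair.AE_commute)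
    have sets: "sets (lborel \<Otimes>\<^sub>M (lborel :: real measure)) = sets (borel :: (real \<times> real) measure)"
      by (metis lborel_prod sets_lborel)
    have "{z. (fst z, snd z - c * fst z) \<notin> N} = (\<lambda>z. (fst z, snd z - c * fst z)) -` (- N)" by auto
    also have "\<dots> \<in> sets (borel :: (real \<times> real) measure)"
      by (rule measurable_sets_borel) (auto intro!: borel_measurable_continuous_onI continuous_intros)
    finally show "{x \<in> space (lborel \<Otimes>\<^sub>M lborel). (fst x, snd x - c * fst x) \<notin> N} \<in> sets (lborel \<Otimes>\<^sub>M lborel)"
      unfolding sets by (simp add: space_pair_measure)
  qed simp
  then show ?thesis
  proof eventually_elim
    case (elim y)
    then show ?case by eventually_elim (use N(2) in auto)
  qed
qed

text \<open>The set where \<open>\<phi>\<close> is negative is open and null, hence empty. This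
  passes from almost every line to every line.\<close>

lemma AE_lborel_nonneg_on_open:
  fixes \<phi> :: "real \<Rightarrow> real"
  assumes U: "open U" "continuous_on U \<phi>" and ae: "AE y in lborel. y \<in> U \<longrightarrow> \<phi> y \<ge> 0" and y: "y \<in> U"
  shows "\<phi> y \<ge> 0"
proof (rule ccontr)
  assume neg: "\<not> \<phi> y \<ge> 0"
  define W where "W = {x \<in> U. \<phi> x < 0}"
  have "W = U \<inter> \<phi> -` {..<0}" by (auto simp: W_def)
  then have W: "open W"
    using continuous_open_preimage[OF U(2,1) open_lessThan] by simp
  have "AE y in lborel. y \<notin> W" using ae by eventually_elim (auto simp: W_def)
  then have "W \<in> null_sets lborel" using W by (subst AE_iff_null_sets) auto
  then have "negligible W" by (simp add: negligible_iff_null_sets null_sets_completionI)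
  with W show False using open_not_negligible[of W] neg y by (force simp: W_def)
qed

text \<open>Halving the step and iterating: \<open>k z \<le> 2 * k (z / 2) + c * z\<^sup>2 / 4\<close> for the deviation \<open>k\<close> of
  \<open>\<phi>\<close> from its tangent, and \<open>2 ^ n * k (z / 2 ^ n)\<close> tends to \<open>0\<close>.\<close>

lemma semiconcave_le_tangent:
  fixes \<phi> :: "real \<Rightarrow> real"
  assumes sc: "\<And>y z. \<phi> (y + z) - 2 * \<phi> y + \<phi> (y - z) \<le> c * z\<^sup>2"
    and der: "(\<phi> has_real_derivative q) (at x)" and c: "c \<ge> 0"
  shows "\<phi> (x + z) \<le> \<phi> x + q * z + c * z\<^sup>2 / 2"
proof (cases "z = 0")
  case False
  define k where "k z = \<phi> (x + z) - \<phi> x - q * z" for z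
  have half: "k z \<le> 2 * k (z / 2) + c * z\<^sup>2 / 4" for z
    using sc[of "x + z / 2" "z / 2"] by (simp add: k_def power_divide algebra_simps)
  have iter: "k z \<le> 2 ^ n * k (z / 2 ^ n) + c * z\<^sup>2 / 2 * (1 - 1 / 2 ^ n)" for n
  proof (induction n)
    case (Suc n)
    have "2 ^ n * k (z / 2 ^ n) \<le> 2 ^ n * (2 * k (z / 2 ^ n / 2) + c * (z / 2 ^ n)\<^sup>2 / 4)"
      by (intro mult_left_mono half) auto
    also have "\<dots> = 2 ^ Suc n * k (z / 2 ^ Suc n) + c * z\<^sup>2 / 2 * (1 / 2 ^ n - 1 / 2 ^ Suc n)"
      by (simp add: power_divide field_simps power2_eq_square)
    finally show ?case using Suc by (simp add: algebra_simps diff_divide_distrib)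
  qed simp
  have "((\<lambda>h. (\<phi> (x + h) - \<phi> x) / h) \<longlongrightarrow> q) (at 0)" using der by (simp add: DERIV_def)
  moreover have "filterlim (\<lambda>n. z / 2 ^ n) (at 0) sequentially"
    using False by (auto simp: filterlim_at intro!: real_tendsto_divide_at_top tendsto_const filterlim_pow_at_top[THEN filterlim_compose] LIMSEQ_divide_realpow_zero)
  ultimately have "(\<lambda>n. (\<phi> (x + z / 2 ^ n) - \<phi> x) / (z / 2 ^ n)) \<longlonglongrightarrow> q" by (rule filterlim_compose)
  then have "(\<lambda>n. z * ((\<phi> (x + z / 2 ^ n) - \<phi> x) / (z / 2 ^ n) - q)) \<longlonglongrightarrow> z * (q - q)" by (intro tendsto_intros)
  moreover have "z * ((\<phi> (x + z / 2 ^ n) - \<phi> x) / (z / 2 ^ n) - q) = 2 ^ n * k (z / 2 ^ n)" for n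
    using False by (simp add: k_def field_simps)
  ultimately have "(\<lambda>n. 2 ^ n * k (z / 2 ^ n)) \<longlonglongrightarrow> 0" by simp
  moreover have "k z - c * z\<^sup>2 / 2 \<le> 2 ^ n * k (z / 2 ^ n)" for n
  proof -
    have "c * z\<^sup>2 / 2 * (1 - 1 / 2 ^ n) \<le> c * z\<^sup>2 / 2 * 1" by (intro mult_left_mono) (use c in auto)
    with iter[of n] show ?thesis by linarith
  qed
  ultimately have "k z - c * z\<^sup>2 / 2 \<le> 0"
    by (intro LIMSEQ_le_const) auto
  then show ?thesis by (simp add: k_def)
qed simp

subsection \<open>The Hamiltonian\<close>

locale bidding =
  fixes T lam K :: real and f :: "real \<Rightarrow> real"
  assumes T_pos: "T > 0" and lam_pos: "lam > 0" and K_pos: "K > 0"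
    and f_int: "set_integrable lborel {0<..} f"
    and f_mass: "(LBINT p:{0<..}. f p) = 1"
    and f_pos: "\<And>p. p > 0 \<Longrightarrow> f p > 0"
    and f_decay: "((\<lambda>p. p ^ 3 * f p) \<longlongrightarrow> 0) at_top"
begin

text \<open>The values of \<open>f\<close> at \<open>p \<le> 0\<close> are arbitrary; cutting them
  off gives a measurable function on the whole line, to which all set integrals can be
  reduced.\<close>

definition f0 :: "real \<Rightarrow> real" where
  "f0 p = indicator {0<..} p * f p"

definition feedback :: "real \<Rightarrow> ennreal" where
  "feedback x = (if x < 0 then ennreal (- 1 / x) else \<infinity>)"

text \<open>Speed at which cash is spent under the optimal bid; \<open>ham_has_derivative\<close>
  identifies it with the derivative of the Hamiltonian.\<close>

definition drift :: "real \<Rightarrow> real" where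
  "drift x = lam * G f (feedback x)"

definition drift_max :: real where
  "drift_max = lam * (LBINT p:{0<..}. p * f p)"

section \<open>Integrability and bounds for the density, \<open>F\<close> and
  \<open>G\<close>\<close>

lemma f0_integrable: "integrable lborel f0"
  using f_int by (simp add: f0_def[abs_def] set_integrable_def)

lemma f0_measurable [measurable]: "f0 \<in> borel_measurable borel"
  using borel_measurable_integrable[OF f0_integrable] by simp

lemma f0_nonneg: "f0 p \<ge> 0"
  using f_pos[of p] by (auto simp: f0_def indicator_def)

lemma f0_nonpos [simp]: "p \<le> 0 \<Longrightarrow> f0 p = 0"
  by (simp add: f0_def)

lemma f0_integral: "(LINT p|lborel. f0 p) = 1"
  using f_mass by (simp add: f0_def[abs_def] set_lebesgue_integral_def)

text \<open>The decay of \<open>p ^ 3 * f p\<close> gives \<open>p * f p \<le> p powr -2\<close>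
  beyond some \<open>P\<close>; below \<open>P\<close> the integrand is at most
  \<open>P * f0 p\<close>.\<close>

lemma moment_integrable: "integrable lborel (\<lambda>p. p * f0 p)"
proof -
  have "eventually (\<lambda>p. p ^ 3 * f p < 1) at_top"
    using f_decay by (rule order_tendstoD) simp
  then obtain P1 where P1: "\<And>p. p \<ge> P1 \<Longrightarrow> p ^ 3 * f p < 1"
    by (auto simp: eventually_at_top_linorder)
  define P where "P = max 1 P1"
  have P: "P \<ge> 1" "\<And>p. p \<ge> P \<Longrightarrow> p ^ 3 * f p < 1" using P1 by (auto simp: P_def)
  have "((\<lambda>x. x powr -2) has_integral -(P powr (-2+1)) / (-2+1)) {P..}"
    using P by (intro has_integral_powr_to_inf) auto
  then have "set_integrable lebesgue {P..} (\<lambda>x. x powr -2)"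
    by (intro nonnegative_absolutely_integrable_1) (auto simp: integrable_on_def)
  then have tail: "integrable lborel (\<lambda>x. indicator {P..} x * x powr -2)"
    by (simp add: set_integrable_def integrable_completion)
  show ?thesis
  proof (rule Bochner_Integration.integrable_bound)
    show "integrable lborel (\<lambda>p. P * f0 p + indicator {P..} p * p powr -2)"
      by (intro Bochner_Integration.integrable_add integrable_mult_right f0_integrable tail)
    show "AE p in lborel. norm (p * f0 p) \<le> norm (P * f0 p + indicator {P..} p * p powr -2)"
    proof (intro AE_I2)
      fix p :: real
      have nn: "0 \<le> P * f0 p" using P f0_nonneg by simp
      show "norm (p * f0 p) \<le> norm (P * f0 p + indicator {P..} p * p powr -2)"
      proof (cases "p < P")
        case True
        have "\<bar>p * f0 p\<bar> \<le> P * f0 p"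
        proof (cases "p \<le> 0")
          case False
          then have "p * f0 p \<le> P * f0 p" using True f0_nonneg by (intro mult_right_mono) auto
          then show ?thesis using False f0_nonneg[of p] by simp
        qed simp
        then show ?thesis using True nn by simp
      next
        case False
        then have p: "p \<ge> P" "p > 0" using P(1) by auto
        have "p * f0 p * p ^ 2 < 1" using P(2)[OF p(1)] p(2) by (simp add: f0_def power3_eq_cube power2_eq_square mult_ac)
        then have "p * f0 p \<le> p powr -2"
          using p(2) by (simp add: powr_minus powr_numeral field_simps)
        then show ?thesis using p nn f0_nonneg[of p] by simp
      qed
    qed
  qed measurable
qed

lemma F_eq: "F f b = (LINT p|lborel. indicator {p. ennreal p \<le> b} p * f0 p)"
  unfolding F_def set_lebesgue_integral_def f0_def
  by (intro Bochner_Integration.integral_cong) (auto simp: indicator_def)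

lemma G_eq: "G f b = (LINT p|lborel. indicator {p. ennreal p \<le> b} p * (p * f0 p))"
  unfolding G_def set_lebesgue_integral_def f0_def
  by (intro Bochner_Integration.integral_cong) (auto simp: indicator_def)

lemma F_measurable [measurable]: "F f \<in> borel_measurable borel"
  unfolding F_eq[abs_def] indicator_def by measurable

lemma G_measurable [measurable]: "G f \<in> borel_measurable borel"
  unfolding G_eq[abs_def] indicator_def by measurable

lemma F_integrable: "integrable lborel (\<lambda>p. indicator {p. ennreal p \<le> b} p * f0 p)"
  by (rule Bochner_Integration.integrable_bound[OF f0_integrable]) (auto simp: indicator_def)

lemma G_integrable: "integrable lborel (\<lambda>p. indicator {p. ennreal p \<le> b} p * (p * f0 p))"
  by (rule Bochner_Integration.integrable_bound[OF moment_integrable]) (auto simp: indicator_def)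

lemma mult_f0_nonneg: "p * f0 p \<ge> 0"
  using f0_nonneg[of p] by (cases "p \<le> 0") auto

lemma F_bounds: "0 \<le> F f b" "F f b \<le> 1"
proof -
  show "0 \<le> F f b" unfolding F_eq by (intro Bochner_Integration.integral_nonneg) (auto simp: f0_nonneg)
  have "F f b \<le> (LINT p|lborel. f0 p)"
    unfolding F_eq by (intro integral_mono F_integrable f0_integrable) (auto simp: f0_nonneg indicator_def)
  then show "F f b \<le> 1" by (simp add: f0_integral)
qed

lemma moment_eq: "(LBINT p:{0<..}. p * f p) = (LINT p|lborel. p * f0 p)"
  unfolding set_lebesgue_integral_def f0_def
  by (intro Bochner_Integration.integral_cong) (auto simp: indicator_def)

lemma G_top: "G f top = (LBINT p:{0<..}. p * f p)"
  unfolding moment_eq G_eq by simp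

lemma G_bounds: "0 \<le> G f b" "lam * G f b \<le> drift_max"
proof -
  show "0 \<le> G f b" unfolding G_eq by (intro Bochner_Integration.integral_nonneg) (auto simp: mult_f0_nonneg)
  have "G f b \<le> (LINT p|lborel. p * f0 p)"
    unfolding G_eq by (intro integral_mono G_integrable moment_integrable) (auto simp: mult_f0_nonneg indicator_def)
  then show "lam * G f b \<le> drift_max" using lam_pos by (simp add: moment_eq drift_max_def)
qed

text \<open>Closed form of \<open>H\<close>: for \<open>p > 0\<close> the factor
  \<open>1 + x * p\<close> is nonnegative exactly on an initial interval, possibly unbounded, so a
  single bid collects its whole positive part.\<close>

definition ham :: "real \<Rightarrow> real" where
  "ham x = lam * (LINT p|lborel. max 0 (1 + x * p) * f0 p)"

lemma ham_integrable: "integrable lborel (\<lambda>p. max 0 (1 + x * p) * f0 p)"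
proof (rule Bochner_Integration.integrable_bound)
  show "integrable lborel (\<lambda>p. f0 p + \<bar>x\<bar> * (p * f0 p))"
    by (intro Bochner_Integration.integrable_add integrable_mult_right f0_integrable moment_integrable)
  show "AE p in lborel. norm (max 0 (1 + x * p) * f0 p) \<le> norm (f0 p + \<bar>x\<bar> * (p * f0 p))"
  proof (intro AE_I2)
    fix p :: real
    show "norm (max 0 (1 + x * p) * f0 p) \<le> norm (f0 p + \<bar>x\<bar> * (p * f0 p))"
    proof (cases "p \<le> 0")
      case False
      then have "max 0 (1 + x * p) \<le> 1 + \<bar>x\<bar> * p" by (auto intro: mult_right_mono add_increasing)
      then have "max 0 (1 + x * p) * f0 p \<le> (1 + \<bar>x\<bar> * p) * f0 p"
        using f0_nonneg by (intro mult_right_mono)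
      then show ?thesis using f0_nonneg[of p] by (simp add: algebra_simps abs_mult)
    qed simp
  qed
qed measurable

lemma F_plus_G_eq:
  "F f b + x * G f b = (LINT p|lborel. indicator {p. ennreal p \<le> b} p * (1 + x * p) * f0 p)"
  and F_plus_G_integrable:
  "integrable lborel (\<lambda>p. indicator {p. ennreal p \<le> b} p * (1 + x * p) * f0 p)"
proof -
  have *: "indicator {p. ennreal p \<le> b} p * (1 + x * p) * f0 p
    = indicator {p. ennreal p \<le> b} p * f0 p + x * (indicator {p. ennreal p \<le> b} p * (p * f0 p))" for p
    by (simp add: algebra_simps)
  show "F f b + x * G f b = (LINT p|lborel. indicator {p. ennreal p \<le> b} p * (1 + x * p) * f0 p)"
    unfolding * F_eq G_eq using F_integrable G_integrable by simp
  show "integrable lborel (\<lambda>p. indicator {p. ennreal p \<le> b} p * (1 + x * p) * f0 p)"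
    unfolding * by (intro Bochner_Integration.integrable_add integrable_mult_right F_integrable G_integrable)
qed

text \<open>On any bid interval the integrand is at most its positive part. This inequality yields
  the subgradient of \<open>ham\<close>, the lower bound on costs and the growth of solutions along
  lines.\<close>

lemma F_plus_G_le_ham: "lam * (F f b + x * G f b) \<le> ham x"
  unfolding ham_def F_plus_G_eq using lam_pos
  by (intro mult_left_mono integral_mono F_plus_G_integrable ham_integrable)
     (auto simp: indicator_def f0_nonneg intro!: mult_right_mono)

lemma le_feedback_iff: "p > 0 \<Longrightarrow> ennreal p \<le> feedback x \<longleftrightarrow> 0 \<le> 1 + x * p"
  by (auto simp: feedback_def field_simps ennreal_le_iff2 add_increasing)

lemma ham_eq_feedback: "ham x = lam * (F f (feedback x) + x * G f (feedback x))"
proof -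
  have "max 0 (1 + x * p) * f0 p = indicator {p. ennreal p \<le> feedback x} p * (1 + x * p) * f0 p" for p
    using le_feedback_iff[of p x] by (cases "p \<le> 0") (auto simp: indicator_def max_def)
  then show ?thesis unfolding ham_def F_plus_G_eq by presburger
qed

lemma ham_eq_drift: "ham x = lam * F f (feedback x) + x * drift x"
  unfolding ham_eq_feedback drift_def by (simp add: algebra_simps)

section \<open>The Hamiltonian as a supremum over bids, and its integral formula\<close>

lemma integral_greaterThanAtMost_eq:
  assumes "b \<ge> 0"
  shows "(LBINT p:{0<..b}. f p * (1 + x * p)) = F f (ennreal b) + x * G f (ennreal b)"
  unfolding F_plus_G_eq set_lebesgue_integral_def
  by (intro Bochner_Integration.integral_cong) (use assms in \<open>auto simp: indicator_def f0_def\<close>)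

text \<open>\<open>H\<close> takes a supremum over finite bids, whereas for \<open>x \<ge> 0\<close>
  the optimal bid is \<open>\<infinity>\<close>; dominated convergence lets large finite bids
  approach its value.\<close>

lemma F_plus_G_tendsto:
  "(\<lambda>n. F f (ennreal (real n)) + x * G f (ennreal (real n))) \<longlonglongrightarrow> F f \<infinity> + x * G f \<infinity>"
  unfolding F_plus_G_eq
proof (rule integral_dominated_convergence[where w = "\<lambda>p. f0 p + \<bar>x\<bar> * (p * f0 p)"])
  show "integrable lborel (\<lambda>p. f0 p + \<bar>x\<bar> * (p * f0 p))"
    by (intro Bochner_Integration.integrable_add integrable_mult_right f0_integrable moment_integrable)
  show "AE p in lborel. (\<lambda>n. indicator {p. ennreal p \<le> ennreal (real n)} p * (1 + x * p) * f0 p)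
    \<longlonglongrightarrow> indicator {p. ennreal p \<le> \<infinity>} p * (1 + x * p) * f0 p"
  proof (intro AE_I2 tendsto_eventually)
    fix p :: real
    have "eventually (\<lambda>n. real n \<ge> p) sequentially"
      using filterlim_real_sequentially by (simp add: filterlim_at_top)
    then show "\<forall>\<^sub>F n in sequentially. indicator {p. ennreal p \<le> ennreal (real n)} p * (1 + x * p) * f0 p
        = indicator {p. ennreal p \<le> \<infinity>} p * (1 + x * p) * f0 p"
      by eventually_elim (auto simp: indicator_def ennreal_leI)
  qed
  show "AE p in lborel. norm (indicator {p. ennreal p \<le> ennreal (real n)} p * (1 + x * p) * f0 p)
    \<le> f0 p + \<bar>x\<bar> * (p * f0 p)" for n
  proof (intro AE_I2)
    fix p :: real
    show "norm (indicator {p. ennreal p \<le> ennreal (real n)} p * (1 + x * p) * f0 p)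
      \<le> f0 p + \<bar>x\<bar> * (p * f0 p)"
    proof (cases "p \<le> 0")
      case False
      have "\<bar>1 + x * p\<bar> \<le> 1 + \<bar>x\<bar> * p" using False abs_triangle_ineq[of 1 "x * p"] by (simp add: abs_mult)
      then have "\<bar>1 + x * p\<bar> * f0 p \<le> (1 + \<bar>x\<bar> * p) * f0 p"
        using f0_nonneg by (intro mult_right_mono)
      moreover have "(1 + \<bar>x\<bar> * p) * f0 p = f0 p + \<bar>x\<bar> * (p * f0 p)" by (simp add: algebra_simps)
      ultimately have "norm ((1 + x * p) * f0 p) \<le> f0 p + \<bar>x\<bar> * (p * f0 p)"
        using f0_nonneg[of p] by (simp add: abs_mult)
      then show ?thesis using f0_nonneg[of p] mult_f0_nonneg[of p] by (auto simp: indicator_def)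
    qed simp
  qed
qed measurable

lemma SUP_eq_ham:
  "lam * (SUP b\<in>{0..}. LBINT p:{0<..b}. f p * (1 + x * p)) = ham x"
proof -
  define J where "J b = F f b + x * G f b" for b
  have J: "(\<lambda>b. LBINT p:{0<..b}. f p * (1 + x * p)) ` {0..} = (\<lambda>b. J (ennreal b)) ` {0..}"
    by (intro image_cong refl) (simp add: integral_greaterThanAtMost_eq J_def)
  have le: "J b \<le> J (feedback x)" for b
    using F_plus_G_le_ham[of b x] lam_pos by (simp add: ham_eq_feedback J_def)
  have "(SUP b\<in>{0..}. J (ennreal b)) = J (feedback x)"
  proof (rule antisym)
    show "(SUP b\<in>{0..}. J (ennreal b)) \<le> J (feedback x)"
      by (rule cSUP_least) (auto intro: le)
    have bdd: "bdd_above ((\<lambda>b. J (ennreal b)) ` {0..})" using le by (auto intro!: bdd_aboveI2)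
    show "J (feedback x) \<le> (SUP b\<in>{0..}. J (ennreal b))"
    proof (cases "x < 0")
      case True
      then show ?thesis by (intro cSUP_upper2[OF bdd, of "-1 / x"]) (auto simp: feedback_def field_simps)
    next
      case False
      have "(\<lambda>n. J (ennreal (real n))) \<longlonglongrightarrow> J (feedback x)"
        using F_plus_G_tendsto False by (simp add: J_def feedback_def)
      then show ?thesis by (rule LIMSEQ_le_const2) (intro exI allI impI cSUP_upper2[OF bdd _ order_refl], simp)
    qed
  qed
  then show ?thesis unfolding J by (simp add: ham_eq_feedback J_def)
qed

lemma H_eq_ham: "H lam f x = ham x"
  unfolding H_def by (rule SUP_eq_ham)

lemma INF_eq_ham:
  "lam * (INF b\<in>{0..}. - (LBINT p:{0<..b}. f p * (1 + x * p))) = - ham x"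
proof -
  have "(INF b\<in>{0..}. - (LBINT p:{0<..b}. f p * (1 + x * p)))
    = - (SUP b\<in>{0..}. LBINT p:{0<..b}. f p * (1 + x * p))"
    unfolding Inf_real_def by (simp add: image_image)
  then show ?thesis using SUP_eq_ham[of x] by simp
qed

lemma ham_nonneg_arg: "x \<ge> 0 \<Longrightarrow> ham x = lam * (1 + x * (LBINT p:{0<..}. p * f p))"
  using f0_integral by (simp add: ham_eq_feedback feedback_def G_top F_eq)

text \<open>With \<open>B = - 1 / x\<close>, the positive part of \<open>1 + x * q\<close> is
  \<open>- x * max 0 (B - q)\<close>, and \<open>max 0 (B - q)\<close> is the length of
  \<open>{q..B}\<close>. Integrating over \<open>q\<close> first turns the double integral into that
  of \<open>F\<close> over \<open>{0..B}\<close>.\<close>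

lemma ham_neg_arg:
  assumes x: "x < 0"
  shows "ham x = - lam * x * (LBINT p:{0..- 1 / x}. F f (ennreal p))"
proof -
  define B where "B = - 1 / x"
  have B: "B > 0" "x * B = -1" using x by (auto simp: B_def field_simps)
  define k :: "real \<Rightarrow> real \<Rightarrow> real" where "k p q = (if 0 \<le> p \<and> p \<le> B \<and> q \<le> p then f0 q else 0)" for p q
  have [measurable]: "case_prod k \<in> borel_measurable (borel \<Otimes>\<^sub>M borel)"
    unfolding k_def by measurable
  have row: "k p q = indicator {0..B} p * (indicator {q. ennreal q \<le> ennreal p} q * f0 q)" for p q
    by (cases "q \<le> 0") (auto simp: k_def indicator_def)
  have row_int: "(LINT q|lborel. k p q) = indicator {0..B} p * F f (ennreal p)" for p
    unfolding row F_eq using F_integrable[of "ennreal p"] by simp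
  have "integrable (lborel \<Otimes>\<^sub>M lborel) (case_prod k)"
  proof (rule lborel_pair.Fubini_integrable)
    have "norm (case (p, q) of (p, q) \<Rightarrow> k p q) = k p q" for p q
      using f0_nonneg by (simp add: k_def)
    moreover have "integrable lborel (\<lambda>p. indicator {0..B} p * F f (ennreal p))"
      by (rule Bochner_Integration.integrable_bound[of _ "indicator {0..B} :: real \<Rightarrow> real"])
         (use F_bounds in \<open>auto simp: integrable_indicator_iff emeasure_lborel_Icc_eq indicator_def\<close>)
    ultimately show "integrable lborel (\<lambda>p. LINT q|lborel. norm (case (p, q) of (p, q) \<Rightarrow> k p q))"
      by (simp add: row_int)
    show "AE p in lborel. integrable lborel (\<lambda>q. case (p, q) of (p, q) \<Rightarrow> k p q)"
      using F_integrable by (auto simp: row)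
  qed simp
  then have "(LINT q|lborel. LINT p|lborel. k p q) = (LINT p|lborel. LINT q|lborel. k p q)"
    by (rule lborel_pair.Fubini_integral)
  also have "\<dots> = (LBINT p:{0..B}. F f (ennreal p))"
    by (simp add: row_int set_lebesgue_integral_def)
  finally have swap: "(LBINT p:{0..B}. F f (ennreal p)) = (LINT q|lborel. LINT p|lborel. k p q)" by simp
  have col: "(LINT p|lborel. k p q) = max 0 (B - q) * f0 q" for q
  proof (cases "q \<le> 0")
    case False
    then have "k p q = indicator {q..B} p * f0 q" for p by (auto simp: k_def indicator_def)
    then show ?thesis by (simp add: max_def)
  qed (simp add: k_def cong: if_cong)
  have "max 0 (1 + x * q) = - x * max 0 (B - q)" for q
  proof -
    have "1 + x * q = (- x) * (B - q)" using B by (simp add: algebra_simps)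
    then show ?thesis using x by (simp add: max_def mult_le_0_iff zero_le_mult_iff)
  qed
  then have "ham x = - lam * x * (LINT q|lborel. max 0 (B - q) * f0 q)"
    unfolding ham_def by (simp add: mult.assoc)
  then show ?thesis unfolding B_def[symmetric] swap col .
qed

text \<open>The bid optimal at \<open>x\<close> is still allowed at \<open>y\<close>, and with the
  bid held fixed the payoff is affine in the argument.\<close>

lemma ham_subgradient: "ham y \<ge> ham x + drift x * (y - x)"
  using F_plus_G_le_ham[of "feedback x" y] unfolding ham_eq_drift[of x] drift_def
  by (simp add: algebra_simps)

section \<open>Monotonicity and smoothness of the Hamiltonian\<close>

lemma drift_bounds: "0 \<le> drift x" "drift x \<le> drift_max"
  unfolding drift_def using G_bounds lam_pos by auto

lemma drift_max_nonneg: "0 \<le> drift_max"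
  using drift_bounds[of 0] by simp

lemma drift_nonneg_arg: "x \<ge> 0 \<Longrightarrow> drift x = drift_max"
  by (simp add: drift_def feedback_def G_top drift_max_def)

lemma drift_mono: "x \<le> y \<Longrightarrow> drift x \<le> drift y"
proof (cases "x = y")
  case False
  assume "x \<le> y"
  have "(drift y - drift x) * (y - x) \<ge> 0"
    using ham_subgradient[of x y] ham_subgradient[of y x] by (simp add: algebra_simps)
  then show ?thesis using False \<open>x \<le> y\<close> by (simp add: zero_le_mult_iff)
qed simp

text \<open>Only the indicator of \<open>0 \<le> 1 + x * p\<close> depends on \<open>x\<close>, and
  it converges at every \<open>p\<close> except a single boundary point, so dominated convergence
  applies.\<close>

lemma drift_isCont: "isCont drift x"
proof -
  have drift_eq: "drift x = lam * (LINT p|lborel. indicator {p. 0 \<le> 1 + x * p} p * (p * f0 p))" for x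
  proof -
    have "indicator {p. ennreal p \<le> feedback x} p * (p * f0 p) = indicator {p. 0 \<le> 1 + x * p} p * (p * f0 p)" for p
      using le_feedback_iff[of p x] by (cases "p \<le> 0") (auto simp: indicator_def)
    then show ?thesis unfolding drift_def G_eq by presburger
  qed
  show ?thesis
  proof (rule continuous_at_sequentiallyI)
    fix u :: "nat \<Rightarrow> real" assume u: "u \<longlonglongrightarrow> x"
    have "(\<lambda>n. LINT p|lborel. indicator {p. 0 \<le> 1 + u n * p} p * (p * f0 p))
       \<longlonglongrightarrow> (LINT p|lborel. indicator {p. 0 \<le> 1 + x * p} p * (p * f0 p))"
    proof (rule integral_dominated_convergence[where w = "\<lambda>p. p * f0 p"])
      \<comment> \<open>For \<open>x = 0\<close> this excludes the point \<open>- 1 / 0 = 0\<close>,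
        which does no harm.\<close>
      have "AE p in lborel. p \<noteq> - 1 / x" by (rule AE_lborel_singleton)
      then show "AE p in lborel. (\<lambda>n. indicator {p. 0 \<le> 1 + u n * p} p * (p * f0 p))
        \<longlonglongrightarrow> indicator {p. 0 \<le> 1 + x * p} p * (p * f0 p)"
      proof eventually_elim
        case (elim p)
        have ne: "1 + x * p \<noteq> 0"
        proof
          assume "1 + x * p = 0"
          moreover from this have "x \<noteq> 0" by auto
          ultimately show False using elim by (simp add: field_simps)
        qed
        have lim: "(\<lambda>n. 1 + u n * p) \<longlonglongrightarrow> 1 + x * p" by (intro tendsto_intros u)
        have "eventually (\<lambda>n. (0 \<le> 1 + u n * p) = (0 \<le> 1 + x * p)) sequentially"
        proof (cases "1 + x * p > 0")
          case True
          from order_tendstoD(1)[OF lim this] show ?thesis by eventually_elim (use True in auto)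
        next
          case False
          then have "1 + x * p < 0" using ne by simp
          from order_tendstoD(2)[OF lim this] show ?thesis by eventually_elim (use False ne in auto)
        qed
        then show ?case
          by (intro tendsto_eventually) (auto elim!: eventually_mono simp: indicator_def)
      qed
    qed (use moment_integrable mult_f0_nonneg in \<open>auto simp: indicator_def\<close>)
    then show "(\<lambda>n. drift (u n)) \<longlonglongrightarrow> drift x" unfolding drift_eq by (rule tendsto_mult_left)
  qed
qed

lemma ham_has_derivative: "(ham has_real_derivative drift x) (at x)"
  by (rule DERIV_of_subgradient[of UNIV]) (auto intro: ham_subgradient drift_isCont)

lemma ham_diff_le: "\<bar>ham x - ham y\<bar> \<le> drift_max * \<bar>x - y\<bar>"
proof -
  have "ham x - ham y \<le> drift_max * \<bar>x - y\<bar>" for x y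
  proof -
    have "ham x - ham y \<le> drift x * (x - y)" using ham_subgradient[of x y] by (simp add: algebra_simps)
    also have "\<dots> \<le> drift x * \<bar>x - y\<bar>" using drift_bounds by (intro mult_left_mono) auto
    also have "\<dots> \<le> drift_max * \<bar>x - y\<bar>" using drift_bounds by (intro mult_right_mono) auto
    finally show ?thesis .
  qed
  from this[of x y] this[of y x] show ?thesis by (simp add: abs_minus_commute)
qed

lemma ham_bounds:
  assumes "x \<le> 0"
  shows "0 \<le> ham x" "ham x \<le> lam"
proof -
  show "0 \<le> ham x"
    unfolding ham_def using lam_pos f0_nonneg by (intro mult_nonneg_nonneg Bochner_Integration.integral_nonneg) auto
  have "ham x \<le> ham 0 - drift x * (0 - x)" using ham_subgradient[of x 0] by simp
  then show "ham x \<le> lam"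
    using assms drift_bounds[of x] ham_nonneg_arg[of 0] mult_nonneg_nonpos[of "drift x" x] by simp
qed

end

subsection \<open>The value function and the optimal feedback\<close>

lemma set_integral_const_on:
  fixes \<phi> :: "real \<Rightarrow> real"
  assumes "\<And>u. u \<in> {a..b} \<Longrightarrow> \<phi> u = c" "a \<le> b"
  shows "(LBINT u:{a..b}. \<phi> u) = (b - a) * c"
proof -
  have "(LBINT u:{a..b}. \<phi> u) = (LBINT u:{a..b}. c)"
    using assms(1) by (intro set_lebesgue_integral_cong) auto
  then show ?thesis using assms(2) by (simp add: set_lebesgue_integral_def)
qed

text \<open>After the last time at which the integral was nonnegative, the integrand is nonnegative,
  so the integral cannot have become negative. This stands in for a Gronwall argument, which would
  ask for a Lipschitz drift.\<close>

lemma indefinite_integral_nonneg_of_restoring_sign: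
  fixes k :: "real \<Rightarrow> real"
  assumes k: "k integrable_on {a..b}" and s: "s \<in> {a..b}"
    and sign: "\<And>u. u \<in> {a..b} \<Longrightarrow> integral {a..u} k < 0 \<Longrightarrow> k u \<ge> 0"
  shows "integral {a..s} k \<ge> 0"
proof (rule ccontr)
  define D where "D u = integral {a..u} k" for u
  assume "\<not> integral {a..s} k \<ge> 0"
  then have neg: "D s < 0" by (simp add: D_def)
  have cont: "continuous_on {a..s} D"
    unfolding D_def by (rule continuous_on_subset[OF indefinite_integral_continuous_1[OF k]]) (use s in auto)
  define Z where "Z = {u \<in> {a..s}. D u \<ge> 0}"
  have "Z = {a..s} \<inter> D -` {0..}" by (auto simp: Z_def)
  then have "compact Z"
    using continuous_closed_preimage[OF cont closed_atLeastAtMost closed_atLeast[of 0]]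
    by (simp add: compact_eq_bounded_closed bounded_subset[OF bounded_closed_interval[of a s]] Z_def)
  moreover have "a \<in> Z" using s by (simp add: Z_def D_def)
  ultimately obtain s0 where s0: "s0 \<in> Z" "\<And>u. u \<in> Z \<Longrightarrow> u \<le> s0"
    using compact_attains_sup[of Z] by blast
  have s0s: "a \<le> s0" "s0 \<le> s" "D s0 \<ge> 0" using s0(1) by (auto simp: Z_def)
  have sub: "{s0..s} \<subseteq> {a..b}" using s s0s by auto
  \<comment> \<open>At \<open>s0\<close> itself the integral is nonnegative and the sign condition
    gives nothing; changing one value leaves the integral intact.\<close>
  define k' where "k' u = (if u = s0 then 0 else k u)" for u
  have "integral {s0..s} k = integral {s0..s} k'"
    by (rule integral_spike[of "{s0}"]) (auto simp: k'_def)
  moreover have "integral {s0..s} k' \<ge> 0"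
  proof (rule Henstock_Kurzweil_Integration.integral_nonneg)
    show "k' integrable_on {s0..s}"
      by (rule integrable_spike[OF integrable_on_subinterval[OF k sub], of "{s0}"]) (auto simp: k'_def)
    fix u assume u: "u \<in> {s0..s}"
    show "k' u \<ge> 0"
    proof (cases "u = s0")
      case False
      then have "u \<notin> Z" using s0(2)[of u] u by auto
      then have "D u < 0" using u s0s by (auto simp: Z_def)
      then show ?thesis using sign[of u] u sub by (auto simp: D_def k'_def)
    qed (simp add: k'_def)
  qed
  moreover have "integral {a..s0} k + integral {s0..s} k = integral {a..s} k"
    using s0s s by (intro Henstock_Kurzweil_Integration.integral_combine integrable_on_subinterval[OF k]) auto
  ultimately show False using neg s0s(3) by (simp add: D_def)
qed

context bidding
begin

text \<open>The root of the first-order condition without the constraint \<open>x \<le> 0\<close>. A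
  nonnegative value encodes the regime of ample cash, where \<open>drift\<close> is
  saturated.\<close>

definition slope :: "real \<Rightarrow> real \<Rightarrow> real" where
  "slope t S = (THE y. S = (T - t) * drift y + y / (2 * K))"

text \<open>Clipping gives the maximiser of the dual functional over \<open>x \<le> 0\<close>, which
  turns out to be the derivative of \<open>V\<close> in \<open>S\<close>.\<close>

definition grad :: "real \<Rightarrow> real \<Rightarrow> real" where
  "grad t S = min (slope t S) 0"

definition V :: "real \<Rightarrow> real \<Rightarrow> real" where
  "V t S = S * grad t S - (T - t) * ham (grad t S) - (grad t S)\<^sup>2 / (4 * K)"

section \<open>Solvability and stability of the first-order condition\<close>

lemma drift_line_strict_mono:
  assumes "t \<le> T" "y < z"
  shows "(T - t) * drift y + y / (2 * K) < (T - t) * drift z + z / (2 * K)"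
  using assms K_pos drift_mono[of y z]
  by (intro add_le_less_mono mult_left_mono) (auto simp: divide_strict_right_mono)

lemma slope_unique:
  assumes "t \<le> T" "S = (T - t) * drift y + y / (2 * K)"
  shows "slope t S = y"
  unfolding slope_def
proof (rule the_equality)
  fix z assume "S = (T - t) * drift z + z / (2 * K)"
  then show "z = y"
    using drift_line_strict_mono[OF assms(1), of y z] drift_line_strict_mono[OF assms(1), of z y] assms(2)
    by (cases z y rule: linorder_cases) auto
qed (rule assms(2))

text \<open>Replacing \<open>drift\<close> by its bounds \<open>0\<close> and
  \<open>drift_max\<close> gives two linear equations whose solutions enclose the root; the
  intermediate value theorem then applies.\<close>

lemma slope_eq:
  assumes t: "t \<le> T"
  shows "S = (T - t) * drift (slope t S) + slope t S / (2 * K)"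
proof -
  define a where "a = 2 * K * (S - (T - t) * drift_max)"
  have "a \<le> 2 * K * S" using t K_pos mult_nonneg_nonneg[of "T - t" drift_max] drift_max_nonneg by (simp add: a_def)
  moreover have "(T - t) * drift a + a / (2 * K) \<le> S"
    using t K_pos drift_bounds(2)[of a] mult_left_mono[of "drift a" drift_max "T - t"] by (simp add: a_def)
  moreover have "S \<le> (T - t) * drift (2 * K * S) + 2 * K * S / (2 * K)"
    using t K_pos drift_bounds(1)[of "2 * K * S"] by simp
  ultimately have "\<exists>y\<ge>a. y \<le> 2 * K * S \<and> (T - t) * drift y + y / (2 * K) = S"
    using K_pos by (intro IVT') (auto intro!: continuous_intros continuous_at_imp_continuous_on drift_isCont)
  then obtain y where "S = (T - t) * drift y + y / (2 * K)" by auto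
  then show ?thesis using slope_unique[OF t] by metis
qed

text \<open>As \<open>drift\<close> is monotone, the right-hand side of the root equation grows in
  \<open>y\<close> at rate at least \<open>1 / (2 * K)\<close>, while time enters only through a
  factor of at most \<open>drift_max\<close>.\<close>

lemma slope_lipschitz:
  assumes "t \<le> T" "t' \<le> T"
  shows "\<bar>slope t S - slope t' S'\<bar> \<le> 2 * K * (\<bar>S - S'\<bar> + drift_max * \<bar>t - t'\<bar>)"
proof -
  have "slope t S - slope t' S' \<le> 2 * K * (\<bar>S - S'\<bar> + drift_max * \<bar>t - t'\<bar>)"
    if t: "t \<le> T" "t' \<le> T" for t t' S S'
  proof (cases "slope t S \<ge> slope t' S'")
    case True
    define y y' where "y = slope t S" and "y' = slope t' S'"
    have eq: "S = (T - t) * drift y + y / (2 * K)" "S' = (T - t') * drift y' + y' / (2 * K)"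
      using slope_eq t by (auto simp: y_def y'_def)
    have "(T - t') * drift y' \<le> (T - t') * drift y"
      using True t by (intro mult_left_mono drift_mono) (auto simp: y_def y'_def)
    moreover have "(t - t') * drift y \<le> \<bar>t - t'\<bar> * drift_max"
      by (intro mult_mono) (auto simp: drift_bounds)
    ultimately have "(y - y') / (2 * K) \<le> \<bar>S - S'\<bar> + drift_max * \<bar>t - t'\<bar>"
      using eq by (simp add: algebra_simps diff_divide_distrib)
    then show ?thesis using K_pos by (simp add: y_def y'_def field_simps)
  next
    case False
    moreover have "2 * K * (\<bar>S - S'\<bar> + drift_max * \<bar>t - t'\<bar>) \<ge> 0" using K_pos drift_max_nonneg by simp
    ultimately show ?thesis by simp
  qed
  from this[of t t' S S'] this[of t' t S' S] assms show ?thesis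
    by (simp add: abs_minus_commute abs_le_iff)
qed

text \<open>At \<open>y = 0\<close> the right-hand side of the root equation equals
  \<open>(T - t) * drift_max\<close>; this is the threshold between finite and infinite
  bids.\<close>

lemma slope_neg_iff:
  assumes "t \<le> T"
  shows "slope t S < 0 \<longleftrightarrow> S < (T - t) * drift_max"
proof -
  have S: "S = (T - t) * drift (slope t S) + slope t S / (2 * K)" by (rule slope_eq[OF assms])
  show ?thesis
  proof (cases "slope t S < 0")
    case True
    from drift_line_strict_mono[OF assms this] have "S < (T - t) * drift_max"
      using S by (simp add: drift_nonneg_arg)
    with True show ?thesis by simp
  next
    case False
    then have "slope t S / (2 * K) \<ge> 0" using K_pos by simp
    then show ?thesis using S False drift_nonneg_arg[of "slope t S"] by simp
  qed
qed

lemma slope_mono: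
  assumes "t \<le> T" "S \<le> S'"
  shows "slope t S \<le> slope t S'"
proof (rule ccontr)
  assume "\<not> slope t S \<le> slope t S'"
  then have "slope t S' < slope t S" by simp
  from drift_line_strict_mono[OF assms(1) this] have "S' < S"
    unfolding slope_eq[OF assms(1), symmetric] .
  then show False using assms(2) by simp
qed

section \<open>The dual value and its regularity\<close>

lemma grad_nonpos: "grad t S \<le> 0"
  by (simp add: grad_def)

lemma grad_lipschitz:
  assumes "t \<le> T" "t' \<le> T"
  shows "\<bar>grad t S - grad t' S'\<bar> \<le> 2 * K * (\<bar>S - S'\<bar> + drift_max * \<bar>t - t'\<bar>)"
  using slope_lipschitz[OF assms, of S S'] unfolding grad_def by linarith

lemma feedback_min_zero: "feedback (min y 0) = feedback y"
  by (auto simp: feedback_def min_def)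

text \<open>First-order optimality for a concave functional: replacing \<open>ham\<close> and the
  square by their tangents at \<open>z\<close> leaves a linear function of slope
  \<open>(y - z) / (2 * K)\<close>. It vanishes for \<open>y \<le> 0\<close>; for
  \<open>y > 0\<close> it is positive, but then \<open>z = 0\<close> and
  \<open>x \<le> 0\<close>.\<close>

lemma V_ge:
  assumes t: "t \<le> T" and x: "x \<le> 0"
  shows "S * x - (T - t) * ham x - x\<^sup>2 / (4 * K) \<le> V t S"
proof -
  define y where "y = slope t S"
  define z where "z = min y 0"
  have S: "S = (T - t) * drift z + y / (2 * K)"
    using slope_eq[OF t, of S] by (simp add: y_def z_def drift_def feedback_min_zero)
  have "(T - t) * (ham z + drift z * (x - z)) \<le> (T - t) * ham x"
    using t by (intro mult_left_mono ham_subgradient) auto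
  moreover have "(z\<^sup>2 + 2 * z * (x - z)) / (4 * K) \<le> x\<^sup>2 / (4 * K)"
    using K_pos zero_le_power2[of "x - z"] by (intro divide_right_mono) (auto simp: power2_eq_square algebra_simps)
  moreover have "(x - z) * (S - (T - t) * drift z - z / (2 * K)) \<le> 0"
    using S x K_pos by (cases "y \<le> 0") (auto simp: z_def intro!: divide_nonpos_pos mult_nonpos_nonneg)
  moreover have "S * z - (T - t) * ham z - z\<^sup>2 / (4 * K) 
     - (S * x - (T - t) * (ham z + drift z * (x - z)) - (z\<^sup>2 + 2 * z * (x - z)) / (4 * K))
     = - ((x - z) * (S - (T - t) * drift z - z / (2 * K)))"
    using K_pos by (simp add: field_simps power2_eq_square)
  moreover have "V t S = S * z - (T - t) * ham z - z\<^sup>2 / (4 * K)"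
    by (simp add: V_def grad_def y_def z_def)
  ultimately show ?thesis by linarith
qed

lemma V_eq_SUP:
  assumes "t \<le> T"
  shows "V t S = (SUP x\<in>{..0}. S * x - (T - t) * ham x - x\<^sup>2 / (4 * K))"
  by (rule cSup_eq_maximum[symmetric])
     (use V_ge[OF assms] grad_nonpos in \<open>auto simp: V_def image_iff intro!: bexI[of _ "grad t S"]\<close>)

text \<open>The multiplier optimal at \<open>(t, S)\<close> stays admissible at
  \<open>(t', S')\<close>, and for a fixed multiplier the dual functional is affine in time and
  cash.\<close>

lemma V_subgradient:
  assumes "t' \<le> T"
  shows "V t' S' \<ge> V t S + grad t S * (S' - S) + ham (grad t S) * (t' - t)"
  using V_ge[OF assms grad_nonpos[of t S], of S'] by (simp add: V_def algebra_simps)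

lemma V_has_derivative_S:
  assumes "t \<le> T"
  shows "((\<lambda>y. V t y) has_real_derivative grad t S) (at S)"
proof (rule DERIV_of_subgradient[of UNIV])
  show "V t z \<ge> V t y + grad t y * (z - y)" for y z
    using V_subgradient[OF assms, of t y z] by simp
  have "continuous_on UNIV (grad t)"
    by (rule lipschitz_on_continuous_on[of "2 * K"], rule lipschitz_onI)
       (use grad_lipschitz[OF assms assms] K_pos in \<open>auto simp: dist_real_def\<close>)
  then show "isCont (grad t) S" by (simp add: continuous_on_eq_continuous_at)
qed auto

lemma V_has_derivative_t:
  assumes "t < T"
  shows "((\<lambda>s. V s S) has_real_derivative ham (grad t S)) (at t)"
proof (rule DERIV_of_subgradient[of "{..<T}"])
  show "V z S \<ge> V y S + ham (grad y S) * (z - y)" if "z \<in> {..<T}" for y z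
    using V_subgradient[of z y S S] that by simp
  have "continuous_on {..<T} (\<lambda>s. ham (grad s S))"
  proof (rule lipschitz_on_continuous_on, rule lipschitz_onI)
    show "0 \<le> drift_max * (2 * K * drift_max)" using K_pos drift_max_nonneg by simp
    fix s s' assume s: "s \<in> {..<T}" "s' \<in> {..<T}"
    have "\<bar>ham (grad s S) - ham (grad s' S)\<bar> \<le> drift_max * \<bar>grad s S - grad s' S\<bar>" by (rule ham_diff_le)
    also have "\<dots> \<le> drift_max * (2 * K * drift_max * \<bar>s - s'\<bar>)"
      using grad_lipschitz[of s s' S S] s drift_max_nonneg by (intro mult_left_mono) (auto simp: mult_ac)
    finally show "dist (ham (grad s S)) (ham (grad s' S)) \<le> drift_max * (2 * K * drift_max) * dist s s'"
      by (simp add: dist_real_def mult_ac)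
  qed
  then show "isCont (\<lambda>s. ham (grad s S)) t" using assms by (simp add: continuous_on_eq_continuous_at)
qed (use assms in auto)

lemma V_terminal: "V T S = K * (min S 0)\<^sup>2"
proof -
  have "slope T S = 2 * K * S" using K_pos by (intro slope_unique) auto
  then have "grad T S = 2 * K * min S 0" using K_pos by (auto simp: grad_def min_def mult_le_0_iff zero_le_mult_iff)
  then show ?thesis using K_pos by (auto simp: V_def power2_eq_square min_def field_simps)
qed

text \<open>The subgradients at \<open>S + z\<close> and \<open>S - z\<close> bound the second
  difference by a difference of gradients, and \<open>grad\<close> is \<open>2 * K\<close>-Lipschitz
  in \<open>S\<close>.\<close>

lemma V_semiconcave:
  assumes "t \<le> T"
  shows "V t (S + z) - 2 * V t S + V t (S - z) \<le> 4 * K * z\<^sup>2"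
proof -
  have "V t (S + z) - 2 * V t S + V t (S - z) \<le> (grad t (S + z) - grad t (S - z)) * z"
    using V_subgradient[OF assms, of t "S + z" S] V_subgradient[OF assms, of t "S - z" S] by (simp add: algebra_simps)
  also have "\<dots> \<le> \<bar>grad t (S + z) - grad t (S - z)\<bar> * \<bar>z\<bar>"
    by (simp add: abs_mult[symmetric])
  also have "\<dots> \<le> (2 * K * (2 * \<bar>z\<bar>)) * \<bar>z\<bar>"
    using grad_lipschitz[OF assms assms, of "S + z" "S - z"] by (intro mult_right_mono) auto
  finally show ?thesis by (simp add: power2_eq_square)
qed

lemma V_locally_lipschitz: "locally_lipschitz_on ({0..T} \<times> UNIV) (\<lambda>(t, S). V t S)"
  unfolding locally_lipschitz_on_def
proof (intro ballI)
  fix z :: "real \<times> real" assume "z \<in> {0..T} \<times> UNIV"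
  \<comment> \<open>Bounds \<open>grad\<close> at cash within distance \<open>1\<close> of
    \<open>snd z\<close>: start from \<open>grad T 0 = 0\<close> and apply the Lipschitz
    estimate.\<close>
  define R where "R = 2 * K * (\<bar>snd z\<bar> + 1 + drift_max * T)"
  have R: "R \<ge> 0" using K_pos T_pos drift_max_nonneg by (simp add: R_def)
  have grad_bd: "\<bar>grad t S\<bar> \<le> R" if "t \<in> {0..T}" "\<bar>S - snd z\<bar> \<le> 1" for t S
  proof -
    have "grad T 0 = 0" using slope_unique[of T 0 0] by (simp add: grad_def)
    then have "\<bar>grad t S\<bar> \<le> 2 * K * (\<bar>S\<bar> + drift_max * \<bar>t - T\<bar>)" using grad_lipschitz[of t T S 0] that by simp
    also have "\<dots> \<le> R" unfolding R_def
      using that K_pos drift_max_nonneg by (intro mult_left_mono add_mono mult_left_mono) auto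
    finally show ?thesis .
  qed
  have one_sided: "V t S - V t' S' \<le> (R + lam) * dist (t, S) (t', S')"
    if "t \<in> {0..T}" "\<bar>S - snd z\<bar> \<le> 1" "t' \<in> {0..T}" for t S t' S'
  proof -
    have "\<bar>S - S'\<bar> \<le> dist (t, S) (t', S')" "\<bar>t - t'\<bar> \<le> dist (t, S) (t', S')"
      using dist_snd_le[of "(t, S)" "(t', S')"] dist_fst_le[of "(t, S)" "(t', S')"] by (auto simp: dist_real_def)
    have "V t S - V t' S' \<le> grad t S * (S - S') + ham (grad t S) * (t - t')"
      using V_subgradient[of t' t S S'] that by (simp add: algebra_simps)
    also have "\<dots> \<le> \<bar>grad t S\<bar> * \<bar>S - S'\<bar> + \<bar>ham (grad t S)\<bar> * \<bar>t - t'\<bar>"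
      by (intro add_mono) (simp_all add: abs_mult[symmetric])
    also have "\<dots> \<le> R * dist (t, S) (t', S') + lam * dist (t, S) (t', S')"
      using grad_bd[OF that(1,2)] ham_bounds[OF grad_nonpos[of t S]] R lam_pos \<open>\<bar>S - S'\<bar> \<le> _\<close> \<open>\<bar>t - t'\<bar> \<le> _\<close>
      by (intro add_mono mult_mono) auto
    finally show ?thesis by (simp add: algebra_simps)
  qed
  have "(R + lam)-lipschitz_on (cball z 1 \<inter> {0..T} \<times> UNIV) (\<lambda>(t, S). V t S)"
  proof (rule lipschitz_onI)
    fix x y assume xy: "x \<in> cball z 1 \<inter> {0..T} \<times> UNIV" "y \<in> cball z 1 \<inter> {0..T} \<times> UNIV"
    have "\<bar>snd x - snd z\<bar> \<le> 1" "\<bar>snd y - snd z\<bar> \<le> 1"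
      using xy dist_snd_le[of z x] dist_snd_le[of z y] by (auto simp: dist_real_def)
    then show "dist (case x of (t, S) \<Rightarrow> V t S) (case y of (t, S) \<Rightarrow> V t S) \<le> (R + lam) * dist x y"
      using one_sided[of "fst x" "snd x" "fst y" "snd y"] one_sided[of "fst y" "snd y" "fst x" "snd x"] xy
      by (auto simp: dist_real_def case_prod_beta dist_commute abs_le_iff)
  qed (use R lam_pos in auto)
  then show "\<exists>e>0. \<exists>L. L-lipschitz_on (cball z e \<inter> {0..T} \<times> UNIV) (\<lambda>(t, S). V t S)"
    by (intro exI[of _ 1] conjI exI[of _ "R + lam"]) auto
qed

section \<open>Costs of admissible controls\<close>

lemma control_integrable:
  fixes \<phi> :: "ennreal \<Rightarrow> real"
  assumes b: "b \<in> controls T t" and s: "s \<le> T"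
    and \<phi>: "\<phi> \<in> borel_measurable borel" "\<And>x. \<bar>\<phi> x\<bar> \<le> B"
  shows "set_integrable lborel {t..s} (\<lambda>u. \<phi> (b u))"
proof -
  have "(\<lambda>u. \<phi> (b u)) \<in> borel_measurable (restrict_space borel {t..T})"
    using b \<phi>(1) unfolding controls_def by (rule measurable_compose)
  then have "set_borel_measurable borel {t..T} (\<lambda>u. \<phi> (b u))"
    by (simp add: borel_measurable_restrict_space_iff set_borel_measurable_def)
  then have "set_borel_measurable borel {t..s} (\<lambda>u. \<phi> (b u))"
    by (rule set_borel_measurable_subset) (use s in auto)
  then have meas: "(\<lambda>u. indicator {t..s} u *\<^sub>R \<phi> (b u)) \<in> borel_measurable lborel"
    by (simp add: set_borel_measurable_def)
  show ?thesis
    unfolding set_integrable_def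
  proof (rule Bochner_Integration.integrable_bound[OF _ meas])
    show "integrable lborel (\<lambda>u. indicator {t..s} u * B)"
      by (simp add: integrable_indicator_iff emeasure_lborel_Icc_eq)
    show "AE u in lborel. norm (indicator {t..s} u *\<^sub>R \<phi> (b u)) \<le> norm (indicator {t..s} u * B)"
      using \<phi>(2) by (intro AE_I2) (auto simp: indicator_def intro: order_trans[OF _ abs_ge_self])
  qed
qed

lemma F_abs_le: "\<bar>F f b\<bar> \<le> 1"
  using F_bounds[of b] by simp

lemma G_abs_le: "\<bar>G f b\<bar> \<le> drift_max / lam"
  using G_bounds[of b] lam_pos by (simp add: field_simps)

text \<open>Legendre duality: \<open>K * (min s 0)\<^sup>2\<close> is the supremum of \<open>x * s - x\<^sup>2 / (4 * K)\<close> over \<open>x \<le> 0\<close>,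
  and \<open>ham x\<close> dominates the running gain of every control at the multiplier \<open>x\<close>.\<close>

lemma cost_ge_V:
  assumes t: "t \<le> T" and b: "b \<in> controls T t"
  shows "V t S \<le> cost T lam K f b t S"
proof -
  define x where "x = grad t S"
  have x: "x \<le> 0" by (simp add: x_def grad_nonpos)
  define IF IG where "IF = (LBINT s:{t..T}. F f (b s))" and "IG = (LBINT s:{t..T}. G f (b s))"
  have int: "set_integrable lborel {t..T} (\<lambda>s. F f (b s))" "set_integrable lborel {t..T} (\<lambda>s. G f (b s))"
    using control_integrable[OF b order_refl F_measurable F_abs_le] 
      control_integrable[OF b order_refl G_measurable G_abs_le] by auto
  have int': "set_integrable lborel {t..T} (\<lambda>s. lam * (F f (b s) + x * G f (b s)))"
    using int by (intro set_integrable_mult_right set_integral_add) auto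
  have "lam * (IF + x * IG) = (LBINT s:{t..T}. lam * (F f (b s) + x * G f (b s)))"
    using int by (simp add: IF_def IG_def set_integral_add)
  also have "\<dots> \<le> (LBINT s:{t..T}. ham x)"
    by (intro set_integral_mono int' F_plus_G_le_ham)
       (simp add: set_integrable_def integrable_indicator_iff emeasure_lborel_Icc_eq)
  also have "\<dots> = (T - t) * ham x" using t by (simp add: set_lebesgue_integral_def)
  finally have gain: "lam * (IF + x * IG) \<le> (T - t) * ham x" .
  define s where "s = S - lam * IG"
  \<comment> \<open>Completing the square; equality holds at
    \<open>x = 2 * K * min s 0\<close>.\<close>
  have "x * s - x\<^sup>2 / (4 * K) \<le> K * (min s 0)\<^sup>2"
  proof -
    have "x * s \<le> x * min s 0" using x by (auto simp: min_def mult_nonpos_nonneg)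
    moreover have "0 \<le> (2 * K * min s 0 - x)\<^sup>2 / (4 * K)" using K_pos by simp
    moreover have "(2 * K * min s 0 - x)\<^sup>2 / (4 * K) = K * (min s 0)\<^sup>2 - x * min s 0 + x\<^sup>2 / (4 * K)"
      using K_pos by (simp add: power2_eq_square field_simps)
    ultimately show ?thesis by linarith
  qed
  then show ?thesis
    using gain by (simp add: cost_def state_def V_def IF_def[symmetric] IG_def[symmetric] x_def[symmetric] s_def algebra_simps)
qed

text \<open>The constant optimal bid ends with cash \<open>y / (2 * K)\<close>, where
  \<open>y\<close> is the root. Its negative part is \<open>x / (2 * K)\<close>, exactly the
  equality case of the duality behind the lower bound.\<close>

lemma cost_feedback_eq_V:
  assumes t: "t \<le> T" and b: "\<And>s. s \<in> {t..T} \<Longrightarrow> b s = feedback (slope t S)"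
  shows "cost T lam K f b t S = V t S"
proof -
  define y where "y = slope t S"
  define x where "x = min y 0"
  have fb: "feedback y = feedback x" by (simp add: x_def feedback_min_zero)
  have S: "S = (T - t) * drift x + y / (2 * K)"
    using slope_eq[OF t, of S] by (simp add: y_def[symmetric] drift_def fb)
  have "(LBINT s:{t..T}. F f (b s)) = (T - t) * F f (feedback x)"
    "(LBINT s:{t..T}. G f (b s)) = (T - t) * G f (feedback x)"
    by (rule set_integral_const_on; simp add: b t y_def[symmetric] fb)+
  then have "cost T lam K f b t S = - lam * ((T - t) * F f (feedback x)) + K * (min (S - (T - t) * drift x) 0)\<^sup>2"
    by (simp add: cost_def state_def drift_def mult_ac)
  also have "min (S - (T - t) * drift x) 0 = x / (2 * K)"
    using S K_pos by (auto simp: x_def min_def divide_le_0_iff)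
  also have "K * (x / (2 * K))\<^sup>2 = x\<^sup>2 / (4 * K)" using K_pos by (simp add: power2_eq_square)
  also have "- lam * ((T - t) * F f (feedback x)) + x\<^sup>2 / (4 * K) = S * x - (T - t) * ham x - x\<^sup>2 / (4 * K)"
  proof -
    have "S * x = (T - t) * drift x * x + x\<^sup>2 / (2 * K)"
    proof -
      \<comment> \<open>Complementary slackness: either \<open>y = x\<close> or
        \<open>x = 0\<close>.\<close>
      have "y * x = x\<^sup>2" by (auto simp: x_def min_def power2_eq_square)
      then show ?thesis using arg_cong[OF S, of "\<lambda>S. S * x"] by (simp add: distrib_right)
    qed
    then show ?thesis by (simp add: ham_eq_drift algebra_simps)
  qed
  finally show ?thesis by (simp add: V_def grad_def x_def y_def)
qed

lemma const_control: "(\<And>s. s \<in> {t..T} \<Longrightarrow> b s = c) \<Longrightarrow> b \<in> controls T t"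
  unfolding controls_def
  by (rule measurable_cong[THEN iffD2, OF _ measurable_const[of c]]) (auto simp: space_restrict_space)

lemma value_fun_eq_V:
  assumes "t \<le> T"
  shows "value_fun T lam K f t S = V t S"
  unfolding value_fun_def
  by (rule cInf_eq_minimum)
     (use cost_ge_V[OF assms] cost_feedback_eq_V[OF assms] const_control in
       \<open>auto intro!: image_eqI[of _ _ "\<lambda>_. feedback (slope t S)"]\<close>)

text \<open>On the straight line the remaining cash is
  \<open>(T - s) * drift y + y / (2 * K)\<close>, so the root \<open>y\<close> never changes and the
  feedback stays constant.\<close>

lemma closed_loop_exists:
  assumes t: "t \<le> T"
  shows "closed_loop T lam f (\<lambda>t S. feedback (slope t S)) t S (\<lambda>s. S - (s - t) * drift (slope t S))"
proof -
  define y where "y = slope t S"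
  have S: "S = (T - t) * drift y + y / (2 * K)" unfolding y_def by (rule slope_eq[OF t])
  have const: "slope s (S - (s - t) * drift y) = y" if "s \<in> {t..T}" for s
    using that S by (intro slope_unique) (auto simp: algebra_simps)
  have "(LBINT u:{t..s}. G f (feedback (slope u (S - (u - t) * drift y)))) = (s - t) * G f (feedback y)"
    if "s \<in> {t..T}" for s
    using that const by (intro set_integral_const_on) auto
  then show ?thesis
    unfolding closed_loop_def state_def y_def[symmetric]
    using const by (auto intro!: const_control[where c = "feedback y"] simp: drift_def)
qed

text \<open>Optimality of a feedback is asked of every closed-loop trajectory. Above the straight
  line the root is larger and cash is spent at least as fast, below it at most as fast, so no
  trajectory can leave the line.\<close>

lemma closed_loop_unique:
  assumes t: "t \<le> T" and X: "closed_loop T lam f (\<lambda>t S. feedback (slope t S)) t S X" and s: "s \<in> {t..T}"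
  shows "X s = S - (s - t) * drift (slope t S)"
proof -
  define y where "y = slope t S"
  define Y where "Y s = S - (s - t) * drift y" for s
  have S: "S = (T - t) * drift y + y / (2 * K)" unfolding y_def by (rule slope_eq[OF t])
  have Y: "slope u (Y u) = y" if "u \<in> {t..T}" for u
    using that S by (intro slope_unique) (auto simp: Y_def algebra_simps)
  define k where "k u = drift (slope u (X u)) - drift y" for u
  have ctrl: "(\<lambda>s. feedback (slope s (X s))) \<in> controls T t" using X by (simp add: closed_loop_def)
  have int: "set_integrable lborel {t..u} (\<lambda>v. drift (slope v (X v)))" if "u \<le> T" for u
    unfolding drift_def
    using control_integrable[OF ctrl that G_measurable G_abs_le] by (intro set_integrable_mult_right) auto
  have k_int: "k integrable_on {t..u}" if "u \<le> T" for u
    unfolding k_def using set_borel_integral_eq_integral(1)[OF int[OF that]] by (intro integrable_diff) auto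
  have XY: "X u = Y u - integral {t..u} k" if u: "u \<in> {t..T}" for u
  proof -
    have "X u = S - (LBINT v:{t..u}. drift (slope v (X v)))"
      using X u by (auto simp: closed_loop_def state_def drift_def)
    also have "(LBINT v:{t..u}. drift (slope v (X v))) = integral {t..u} (\<lambda>v. drift (slope v (X v)))"
      using u by (intro set_borel_integral_eq_integral(2) int) auto
    also have "\<dots> = integral {t..u} (\<lambda>v. k v + drift y)" by (simp add: k_def)
    also have "\<dots> = integral {t..u} k + (u - t) * drift y"
      using k_int[of u] u by (subst Henstock_Kurzweil_Integration.integral_add) auto
    finally show ?thesis by (simp add: Y_def)
  qed
  have "integral {t..s} k \<ge> 0"
  proof (rule indefinite_integral_nonneg_of_restoring_sign[OF k_int[OF order_refl] s])
    fix u assume u: "u \<in> {t..T}" "integral {t..u} k < 0"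
    then have "y \<le> slope u (X u)" using slope_mono[of u "Y u" "X u"] XY[of u] Y[of u] by auto
    then show "k u \<ge> 0" by (simp add: k_def drift_mono)
  qed
  moreover have "integral {t..s} (\<lambda>u. - k u) \<ge> 0"
  proof (rule indefinite_integral_nonneg_of_restoring_sign[OF _ s])
    show "(\<lambda>u. - k u) integrable_on {t..T}" using k_int by (auto simp: integrable_neg)
    fix u assume u: "u \<in> {t..T}" "integral {t..u} (\<lambda>u. - k u) < 0"
    then have "slope u (X u) \<le> y" using slope_mono[of u "X u" "Y u"] XY[of u] Y[of u] by auto
    then show "- k u \<ge> 0" by (simp add: k_def drift_mono)
  qed
  ultimately show ?thesis using XY[OF s] by (simp add: Y_def y_def)
qed

lemma feedback_optimal: "optimal_control_function T lam K f (\<lambda>t S. feedback (slope t S))"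
  unfolding optimal_control_function_def
proof (intro ballI allI conjI impI)
  fix t S assume "t \<in> {0..T}"
  then have t: "t \<le> T" by simp
  show "\<exists>X. closed_loop T lam f (\<lambda>t S. feedback (slope t S)) t S X" using closed_loop_exists[OF t] by blast
  fix X assume X: "closed_loop T lam f (\<lambda>t S. feedback (slope t S)) t S X"
  have "feedback (slope s (X s)) = feedback (slope t S)" if "s \<in> {t..T}" for s
  proof -
    have "X s = (T - s) * drift (slope t S) + slope t S / (2 * K)"
      using closed_loop_unique[OF t X that] slope_eq[OF t, of S] by (simp add: algebra_simps)
    then show ?thesis using slope_unique[of s "X s" "slope t S"] that by simp
  qed
  then show "cost T lam K f (\<lambda>s. feedback (slope s (X s))) t S = value_fun T lam K f t S"
    using cost_feedback_eq_V[OF t] value_fun_eq_V[OF t] by simp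
qed

lemma V_weak_semiconcave_solution: "weak_semiconcave_solution T lam K f (value_fun T lam K f)"
  unfolding weak_semiconcave_solution_def
proof (intro conjI)
  show "locally_lipschitz_on ({0..T} \<times> UNIV) (\<lambda>(t, S). value_fun T lam K f t S)"
    unfolding locally_lipschitz_on_def
  proof
    fix z :: "real \<times> real" assume "z \<in> {0..T} \<times> UNIV"
    then obtain e L where e: "e > 0" "L-lipschitz_on (cball z e \<inter> {0..T} \<times> UNIV) (\<lambda>(t, S). V t S)"
      using V_locally_lipschitz unfolding locally_lipschitz_on_def by blast
    from e(2) have "L-lipschitz_on (cball z e \<inter> {0..T} \<times> UNIV) (\<lambda>(t, S). value_fun T lam K f t S)"
      by (rule lipschitz_on_transform) (auto simp: value_fun_eq_V)
    then show "\<exists>e>0. \<exists>L. L-lipschitz_on (cball z e \<inter> {0..T} \<times> UNIV) (\<lambda>(t, S). value_fun T lam K f t S)"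
      using e(1) by blast
  qed
  show "\<forall>S. value_fun T lam K f T S = K * (min S 0)\<^sup>2" by (simp add: value_fun_eq_V V_terminal)
  \<comment> \<open>Equality with \<open>V\<close> is available for times up to \<open>T\<close>, so
    the time derivative is transferred inside the open set \<open>{..<T}\<close>.\<close>
  have "((\<lambda>s. value_fun T lam K f s S) has_real_derivative ham (grad t S)) (at t)" if "t < T" for t S
    using V_has_derivative_t[OF that]
    by (rule has_field_derivative_transform_within_open[of _ _ _ "{..<T}"]) (use that in \<open>auto simp: value_fun_eq_V\<close>)
  moreover have "((\<lambda>y. value_fun T lam K f t y) has_real_derivative grad t S) (at S)" if "t < T" for t S
    using V_has_derivative_S[of t S] that by (simp add: value_fun_eq_V)
  ultimately show "AE (t, S) in lborel. t \<in> {0<..<T} \<longrightarrow>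
        (\<exists>vt vS. ((\<lambda>s. value_fun T lam K f s S) has_real_derivative vt) (at t) \<and>
                 ((\<lambda>y. value_fun T lam K f t y) has_real_derivative vS) (at S) \<and>
                 - vt - lam * (INF b\<in>{0..}. - (LBINT p:{0<..b}. f p * (1 + p * vS))) = 0)"
    using INF_eq_ham by (intro AE_I2) (auto simp: mult.commute[of _ "grad _ _"] intro!: exI)
  show "\<exists>C\<ge>0. \<forall>t\<in>{0..<T}. \<forall>S z. value_fun T lam K f t (S + z) - 2 * value_fun T lam K f t S
          + value_fun T lam K f t (S - z) \<le> C * (1 + 1 / (T - t)) * z\<^sup>2"
  proof (intro exI[of _ "4 * K"] conjI ballI allI)
    fix t S z assume t: "t \<in> {0..<T}"
    have "4 * K * 1 * z\<^sup>2 \<le> 4 * K * (1 + 1 / (T - t)) * z\<^sup>2"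
      using t K_pos by (intro mult_right_mono mult_left_mono) auto
    then show "value_fun T lam K f t (S + z) - 2 * value_fun T lam K f t S
          + value_fun T lam K f t (S - z) \<le> 4 * K * (1 + 1 / (T - t)) * z\<^sup>2"
      using V_semiconcave[of t S z] t by (simp add: value_fun_eq_V)
  qed (use K_pos in auto)
qed

end

subsection \<open>Uniqueness of semi-concave solutions\<close>

text \<open>The touching inequality at \<open>- z\<close> together with semi-concavity gives a
  matching upper bound at \<open>z\<close>, so \<open>\<phi>\<close> lies between two parabolas with
  common tangent slope \<open>p\<close>.\<close>

lemma semiconcave_touched_below_DERIV:
  fixes \<phi> :: "real \<Rightarrow> real"
  assumes sc: "\<And>z. \<phi> (x + z) - 2 * \<phi> x + \<phi> (x - z) \<le> c * z\<^sup>2"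
    and touch: "\<And>z. \<bar>z\<bar> < \<rho> \<Longrightarrow> \<phi> x + p * z - B * z\<^sup>2 \<le> \<phi> (x + z)"
    and "\<rho> > 0" "B \<ge> 0" "c \<ge> 0"
  shows "(\<phi> has_real_derivative p) (at x)"
  unfolding DERIV_def
proof (rule LIM_zero_cancel, rule Lim_null_comparison[where g = "\<lambda>z. (c + B) * \<bar>z\<bar>"])
  show "((\<lambda>z. (c + B) * \<bar>z\<bar>) \<longlongrightarrow> 0) (at 0)" by (auto intro!: tendsto_eq_intros)
  have "eventually (\<lambda>z. \<bar>z\<bar> < \<rho> \<and> z \<noteq> 0) (at 0)"
    using assms(3) by (auto simp: eventually_at dist_real_def intro!: exI[of _ \<rho>])
  then show "\<forall>\<^sub>F z in at 0. norm ((\<phi> (x + z) - \<phi> x) / z - p) \<le> (c + B) * \<bar>z\<bar>"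
  proof eventually_elim
    case (elim z)
    have "\<phi> x + p * z - B * z\<^sup>2 \<le> \<phi> (x + z)" using touch[of z] elim by simp
    moreover have "\<phi> (x + z) \<le> \<phi> x + p * z + (c + B) * z\<^sup>2"
      using touch[of "- z"] elim sc[of z] by (simp add: algebra_simps)
    moreover have "0 \<le> c * z\<^sup>2" using assms(5) by simp
    ultimately have "\<bar>\<phi> (x + z) - \<phi> x - p * z\<bar> \<le> (c + B) * \<bar>z\<bar> * \<bar>z\<bar>"
      by (simp add: abs_le_iff algebra_simps power2_eq_square abs_mult_self_eq)
    moreover have "\<phi> (x + z) - \<phi> x - p * z = ((\<phi> (x + z) - \<phi> x) / z - p) * z" using elim by (simp add: field_simps)
    ultimately have "\<bar>(\<phi> (x + z) - \<phi> x) / z - p\<bar> * \<bar>z\<bar> \<le> (c + B) * \<bar>z\<bar> * \<bar>z\<bar>" by (simp add: abs_mult)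
    then show ?case using elim by (simp add: mult_le_cancel_right)
  qed
qed

lemma locally_lipschitz_on_uminus:
  fixes u :: "'a::metric_space \<Rightarrow> 'b::real_normed_vector"
  shows "locally_lipschitz_on U u \<Longrightarrow> locally_lipschitz_on U (\<lambda>x. - u x)"
  unfolding locally_lipschitz_on_def by simp

locale bidding_solution = bidding +
  fixes v :: "real \<Rightarrow> real \<Rightarrow> real"
  assumes sol: "weak_semiconcave_solution T lam K f v"
begin

section \<open>Regularity of an arbitrary semi-concave solution\<close>

lemma v_lipschitz: "locally_lipschitz_on ({0..T} \<times> UNIV) (\<lambda>(t, S). v t S)"
  and v_terminal: "v T S = K * (min S 0)\<^sup>2"
  using sol by (auto simp: weak_semiconcave_solution_def)

lemma v_equation:
  "AE (t, S) in lborel. t \<in> {0<..<T} \<longrightarrow>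
     (\<exists>q. ((\<lambda>s. v s S) has_real_derivative ham q) (at t) \<and> (v t has_real_derivative q) (at S))"
proof -
  have eq: "lam * (INF b\<in>{0..}. - (LBINT p:{0<..b}. f p * (1 + p * q))) = - ham q" for q
    using INF_eq_ham[of q] by (simp add: mult.commute)
  have "AE (t, S) in lborel. t \<in> {0<..<T} \<longrightarrow>
        (\<exists>vt vS. ((\<lambda>s. v s S) has_real_derivative vt) (at t) \<and>
                 ((\<lambda>y. v t y) has_real_derivative vS) (at S) \<and>
                 - vt - lam * (INF b\<in>{0..}. - (LBINT p:{0<..b}. f p * (1 + p * vS))) = 0)"
    using sol by (simp add: weak_semiconcave_solution_def)
  then show ?thesis unfolding eq by eventually_elim auto
qed

lemma v_continuous: "continuous_on ({0..T} \<times> UNIV) (\<lambda>(t, S). v t S)"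
  using v_lipschitz by (rule locally_lipschitz_on_imp_continuous_on)

lemma v_continuous_compose:
  assumes "continuous_on A a" "continuous_on A b" "\<And>x. x \<in> A \<Longrightarrow> a x \<in> {0..T}"
  shows "continuous_on A (\<lambda>x. v (a x) (b x))"
proof -
  have "(\<lambda>x. (a x, b x)) ` A \<subseteq> {0..T} \<times> UNIV" using assms(3) by blast
  from continuous_on_compose2[OF v_continuous continuous_on_Pair[OF assms(1,2)] this] show ?thesis by simp
qed

lemma v_line_lipschitz:
  assumes "{a..b} \<subseteq> {0..T}"
  shows "locally_lipschitz_on {a..b} (\<lambda>t. v t (y - c * t))"
proof -
  have lip: "(1 + \<bar>c\<bar>)-lipschitz_on {a..b} (\<lambda>t. (t, y - c * t))"
  proof (rule lipschitz_onI)
    fix s t :: real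
    have "dist (s, y - c * s) (t, y - c * t) \<le> \<bar>s - t\<bar> + \<bar>(y - c * s) - (y - c * t)\<bar>"
      using norm_Pair_le[of "s - t" "(y - c * s) - (y - c * t)"] by (simp add: dist_norm)
    also have "(y - c * s) - (y - c * t) = - c * (s - t)" by (simp add: algebra_simps)
    finally show "dist (s, y - c * s) (t, y - c * t) \<le> (1 + \<bar>c\<bar>) * dist s t"
      by (simp add: dist_real_def abs_mult distrib_right)
  qed simp
  have "(\<lambda>t. (t, y - c * t)) ` {a..b} \<subseteq> {0..T} \<times> UNIV" using assms by blast
  from locally_lipschitz_on_compose[OF v_lipschitz lip this] show ?thesis by simp
qed

text \<open>With the step \<open>z\<close> fixed, the increment depends continuously on its base
  point; this carries information at \<open>(t0, S0)\<close> over to nearby points.\<close>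

lemma v_increment_near:
  assumes "t0 \<in> {0..T}" "e > 0"
  shows "\<exists>d>0. \<forall>t\<in>{0..T}. \<forall>S. \<bar>t - t0\<bar> < d \<longrightarrow> \<bar>S - S0\<bar> < d \<longrightarrow>
     \<bar>(v t (S + z) - v t S) - (v t0 (S0 + z) - v t0 S0)\<bar> < e"
proof -
  have "continuous_on ({0..T} \<times> UNIV) (\<lambda>x. v (fst x) (snd x + z) - v (fst x) (snd x))"
    by (intro continuous_intros v_continuous_compose) auto
  from this[unfolded continuous_on_iff, rule_format, of "(t0, S0)" e] assms obtain d where d: "d > 0"
    "\<And>t S. t \<in> {0..T} \<Longrightarrow> dist (t, S) (t0, S0) < d \<Longrightarrow>
     \<bar>(v t (S + z) - v t S) - (v t0 (S0 + z) - v t0 S0)\<bar> < e"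
    by (auto simp: dist_real_def)
  have "dist (t, S) (t0, S0) < d" if "\<bar>t - t0\<bar> < d / 2" "\<bar>S - S0\<bar> < d / 2" for t S
    using norm_Pair_le[of "t - t0" "S - S0"] that by (simp add: dist_norm)
  then show ?thesis using d by (intro exI[of _ "d / 2"]) auto
qed

definition semiconcavity :: real where
  "semiconcavity = (SOME C. C \<ge> 0 \<and> (\<forall>t\<in>{0..<T}. \<forall>S z.
        v t (S + z) - 2 * v t S + v t (S - z) \<le> C * (1 + 1 / (T - t)) * z\<^sup>2))"

lemma v_semiconcave:
  "semiconcavity \<ge> 0"
  "t \<in> {0..<T} \<Longrightarrow> v t (S + z) - 2 * v t S + v t (S - z) \<le> semiconcavity * (1 + 1 / (T - t)) * z\<^sup>2"
proof -
  have "\<exists>C\<ge>0. \<forall>t\<in>{0..<T}. \<forall>S z.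
        v t (S + z) - 2 * v t S + v t (S - z) \<le> C * (1 + 1 / (T - t)) * z\<^sup>2"
    using sol by (simp add: weak_semiconcave_solution_def)
  from someI_ex[OF this] show "semiconcavity \<ge> 0"
    "t \<in> {0..<T} \<Longrightarrow> v t (S + z) - 2 * v t S + v t (S - z) \<le> semiconcavity * (1 + 1 / (T - t)) * z\<^sup>2"
    unfolding semiconcavity_def by blast+
qed

text \<open>Semi-concavity bounds the increment of a small fixed step by the tangent up to a
  quadratic error; the steps \<open>z\<close> and \<open>- z\<close> then squeeze nearby slopes
  towards \<open>p\<close>. Derivatives in \<open>S\<close>, where they exist, are thus continuous
  at \<open>(t0, S0)\<close>.\<close>

lemma gradients_near:
  assumes t0: "t0 \<in> {0..<T}" and der: "(v t0 has_real_derivative p) (at S0)" and \<eta>: "\<eta> > 0"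
  shows "\<exists>\<delta>>0. \<forall>t S q. t \<in> {0..<T} \<longrightarrow> \<bar>t - t0\<bar> < \<delta> \<longrightarrow> \<bar>S - S0\<bar> < \<delta> \<longrightarrow>
    (v t has_real_derivative q) (at S) \<longrightarrow> \<bar>q - p\<bar> \<le> \<eta>"
proof -
  \<comment> \<open>One third each for the difference quotient at \<open>(t0, S0)\<close>, the
    change of base point and the quadratic error.\<close>
  define \<epsilon> where "\<epsilon> = \<eta> / 3"
  have \<epsilon>: "\<epsilon> > 0" using \<eta> by (simp add: \<epsilon>_def)
  \<comment> \<open>Times within half the distance to \<open>T\<close> keep
    \<open>1 / (T - t)\<close> at most \<open>1 / \<delta>0\<close>.\<close>
  define \<delta>0 where "\<delta>0 = (T - t0) / 2"
  have \<delta>0: "\<delta>0 > 0" using t0 by (simp add: \<delta>0_def)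
  define c where "c = semiconcavity * (1 + 1 / \<delta>0)"
  have c: "c \<ge> 0" using v_semiconcave(1) \<delta>0 by (simp add: c_def)
  have sc: "v t (S + z) - 2 * v t S + v t (S - z) \<le> c * z\<^sup>2" if "t \<in> {0..<T}" "\<bar>t - t0\<bar> < \<delta>0" for t S z
  proof -
    have "T - t0 = 2 * \<delta>0" by (simp add: \<delta>0_def)
    then have "\<delta>0 \<le> T - t" using that(2) by linarith
    then have "semiconcavity * (1 + 1 / (T - t)) * z\<^sup>2 \<le> c * z\<^sup>2"
      unfolding c_def using v_semiconcave(1) \<delta>0
      by (intro mult_right_mono mult_left_mono add_left_mono divide_left_mono) auto
    then show ?thesis using v_semiconcave(2)[OF that(1), of S z] by linarith
  qed
  have "((\<lambda>z. (v t0 (S0 + z) - v t0 S0) / z) \<longlongrightarrow> p) (at 0)" using der by (simp add: DERIV_def)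
  from LIM_D[OF this \<epsilon>] obtain d where d: "d > 0"
    "\<And>z. z \<noteq> 0 \<Longrightarrow> \<bar>z\<bar> < d \<Longrightarrow> \<bar>(v t0 (S0 + z) - v t0 S0) / z - p\<bar> < \<epsilon>" by auto
  define z where "z = min (d / 2) (\<epsilon> / (c + 1))"
  have z: "z > 0" "z < d" "c * z \<le> \<epsilon>"
  proof -
    show "z > 0" "z < d" using d(1) \<epsilon> c by (auto simp: z_def)
    have "c * z \<le> c * (\<epsilon> / (c + 1))" using c by (intro mult_left_mono) (auto simp: z_def)
    also have "\<dots> \<le> \<epsilon>" using c \<epsilon> by (simp add: field_simps)
    finally show "c * z \<le> \<epsilon>" .
  qed
  have ez: "\<epsilon> * z > 0" using \<epsilon> z by simp
  have t0': "t0 \<in> {0..T}" using t0 by auto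
  obtain d1 where d1: "d1 > 0" "\<And>t S. t \<in> {0..T} \<Longrightarrow> \<bar>t - t0\<bar> < d1 \<Longrightarrow> \<bar>S - S0\<bar> < d1 \<Longrightarrow>
     \<bar>(v t (S + z) - v t S) - (v t0 (S0 + z) - v t0 S0)\<bar> < \<epsilon> * z"
    using v_increment_near[OF t0' ez, of S0 z] by blast
  obtain d2 where d2: "d2 > 0" "\<And>t S. t \<in> {0..T} \<Longrightarrow> \<bar>t - t0\<bar> < d2 \<Longrightarrow> \<bar>S - S0\<bar> < d2 \<Longrightarrow>
     \<bar>(v t (S + - z) - v t S) - (v t0 (S0 + - z) - v t0 S0)\<bar> < \<epsilon> * z"
    using v_increment_near[OF t0' ez, of S0 "- z"] by blast
  have pos: "v t0 (S0 + z) - v t0 S0 \<ge> (p - \<epsilon>) * z"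
    using d(2)[of z] z(1,2) by (auto simp: abs_less_iff field_simps)
  have neg: "v t0 (S0 + - z) - v t0 S0 \<ge> - (p + \<epsilon>) * z"
    using d(2)[of "- z"] z(1,2) by (auto simp: abs_less_iff field_simps)
  show ?thesis
  proof (intro exI[of _ "min \<delta>0 (min d1 d2)"] conjI allI impI)
    fix t S q
    assume t: "t \<in> {0..<T}" "\<bar>t - t0\<bar> < min \<delta>0 (min d1 d2)" "\<bar>S - S0\<bar> < min \<delta>0 (min d1 d2)"
      and q: "(v t has_real_derivative q) (at S)"
    have tan: "v t (S + y) \<le> v t S + q * y + c * y\<^sup>2 / 2" for y
      by (rule semiconcave_le_tangent[OF _ q c]) (use sc t in auto)
    have cz: "c * z\<^sup>2 / 2 \<le> \<epsilon> * z"
      using mult_right_mono[OF z(3), of z] z(1) ez unfolding power2_eq_square by linarith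
    have "(p - 3 * \<epsilon>) * z \<le> q * z"
      using tan[of z] d1(2)[of t S] t pos cz by (auto simp: algebra_simps abs_less_iff)
    moreover have "q * z \<le> (p + 3 * \<epsilon>) * z"
      using tan[of "- z"] d2(2)[of t S] t neg cz by (auto simp: algebra_simps abs_less_iff)
    ultimately show "\<bar>q - p\<bar> \<le> \<eta>" using z(1) by (simp add: \<epsilon>_def abs_le_iff)
  qed (use \<delta>0 d1(1) d2(1) in auto)
qed

text \<open>By \<open>gradients_near\<close> and the equation, the derivatives in \<open>t\<close> near \<open>(t0, S0)\<close> are almost
  everywhere close to \<open>ham p\<close>: wherever the derivative in \<open>S\<close> exists, \<open>v\<close> is differentiable and
  satisfies the equation.\<close>

lemma time_increment_near:
  assumes t0: "t0 \<in> {0..<T}" and der: "(v t0 has_real_derivative p) (at S0)" and \<eta>: "\<eta> > 0"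
  obtains \<delta> where "\<delta> > 0"
    "\<And>t t' S. t \<in> {0..T} \<Longrightarrow> t' \<in> {0..T} \<Longrightarrow> \<bar>t - t0\<bar> < \<delta> \<Longrightarrow> \<bar>t' - t0\<bar> < \<delta> \<Longrightarrow> \<bar>S - S0\<bar> < \<delta> \<Longrightarrow>
       \<bar>v t' S - v t S - ham p * (t' - t)\<bar> \<le> \<eta> * \<bar>t' - t\<bar>"
proof -
  \<comment> \<open>Chosen through the Lipschitz constant \<open>drift_max\<close> of
    \<open>ham\<close>; adding \<open>1\<close> avoids a division by zero.\<close>
  define \<epsilon> where "\<epsilon> = \<eta> / (drift_max + 1)"
  have \<epsilon>: "\<epsilon> > 0" "drift_max * \<epsilon> \<le> \<eta>"
    using \<eta> drift_max_nonneg by (auto simp: \<epsilon>_def field_simps)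
  obtain \<delta> where \<delta>: "\<delta> > 0" "\<And>t S q. t \<in> {0..<T} \<Longrightarrow> \<bar>t - t0\<bar> < \<delta> \<Longrightarrow> \<bar>S - S0\<bar> < \<delta> \<Longrightarrow>
    (v t has_real_derivative q) (at S) \<Longrightarrow> \<bar>q - p\<bar> \<le> \<epsilon>"
    using gradients_near[OF t0 der \<epsilon>(1)] by blast
  have AE_S: "AE S in lborel. AE t in lborel. t \<in> {0<..<T} \<longrightarrow>
     (\<exists>q. ((\<lambda>s. v s S) has_real_derivative ham q) (at t) \<and> (v t has_real_derivative q) (at S))"
    using AE_lborel_sheared_lines[OF v_equation, of 0] by simp
  define U where "U = {S0 - \<delta><..<S0 + \<delta>}"
  have U_iff: "S \<in> U \<longleftrightarrow> \<bar>S - S0\<bar> < \<delta>" for S by (auto simp: U_def abs_less_iff)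
  have inc: "\<bar>v t' S - v t S - ham p * (t' - t)\<bar> \<le> \<eta> * (t' - t)"
    if t: "t \<in> {0..T}" "t' \<in> {0..T}" "\<bar>t - t0\<bar> < \<delta>" "\<bar>t' - t0\<bar> < \<delta>" "t \<le> t'" and S: "S \<in> U" for t t' S
  proof -
    have sub: "{t..t'} \<subseteq> {0..T}" using t by auto
    have ae: "AE S in lborel. S \<in> U \<longrightarrow> \<bar>v t' S - v t S - ham p * (t' - t)\<bar> \<le> \<eta> * (t' - t)"
      using AE_S
    proof eventually_elim
      case (elim S)
      show ?case
      proof
        assume "S \<in> U"
        then have S: "\<bar>S - S0\<bar> < \<delta>" by (simp add: U_iff)
        have der_t: "AE s in lborel. s \<in> {t<..<t'} \<longrightarrow> (\<exists>d. \<bar>d - ham p\<bar> \<le> \<eta> \<and> ((\<lambda>s. v s S) has_real_derivative d) (at s))"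
          using elim
        proof eventually_elim
          case (elim s)
          show ?case
          proof
            assume s: "s \<in> {t<..<t'}"
            then have s': "s \<in> {0<..<T}" "s \<in> {0..<T}" "\<bar>s - t0\<bar> < \<delta>" using t by auto
            then obtain q where q: "((\<lambda>s. v s S) has_real_derivative ham q) (at s)" "(v s has_real_derivative q) (at S)"
              using elim by auto
            have "\<bar>ham q - ham p\<bar> \<le> drift_max * \<bar>q - p\<bar>" by (rule ham_diff_le)
            also have "\<dots> \<le> drift_max * \<epsilon>"
              using \<delta>(2)[OF s'(2,3) S q(2)] drift_max_nonneg by (intro mult_left_mono) auto
            finally show "\<exists>d. \<bar>d - ham p\<bar> \<le> \<eta> \<and> ((\<lambda>s. v s S) has_real_derivative d) (at s)"
              using q(1) \<epsilon>(2) by (intro exI[of _ "ham q"]) auto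
          qed
        qed
        have lip: "locally_lipschitz_on {t..t'} (\<lambda>s. v s S)" using v_line_lipschitz[OF sub, of S 0] by simp
        have "(ham p - \<eta>) * (t' - t) \<le> v t' S - v t S"
        proof (rule locally_lipschitz_AE_deriv_ge[OF t(5) lip])
          show "AE s in lborel. s \<in> {t<..<t'} \<longrightarrow> (\<exists>d\<ge>ham p - \<eta>. ((\<lambda>s. v s S) has_real_derivative d) (at s))"
            using der_t
          proof eventually_elim
            case (elim s)
            show ?case
            proof
              assume "s \<in> {t<..<t'}"
              then obtain d where "\<bar>d - ham p\<bar> \<le> \<eta>" "((\<lambda>s. v s S) has_real_derivative d) (at s)" using elim by auto
              then show "\<exists>d\<ge>ham p - \<eta>. ((\<lambda>s. v s S) has_real_derivative d) (at s)"
                by (intro exI[of _ d]) auto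
            qed
          qed
        qed
        moreover have "- (ham p + \<eta>) * (t' - t) \<le> - v t' S - - v t S"
        proof (rule locally_lipschitz_AE_deriv_ge[OF t(5) locally_lipschitz_on_uminus[OF lip]])
          show "AE s in lborel. s \<in> {t<..<t'} \<longrightarrow> (\<exists>d\<ge>- (ham p + \<eta>). ((\<lambda>s. - v s S) has_real_derivative d) (at s))"
            using der_t
          proof eventually_elim
            case (elim s)
            show ?case
            proof
              assume "s \<in> {t<..<t'}"
              then obtain d where "\<bar>d - ham p\<bar> \<le> \<eta>" "((\<lambda>s. v s S) has_real_derivative d) (at s)" using elim by auto
              then show "\<exists>d\<ge>- (ham p + \<eta>). ((\<lambda>s. - v s S) has_real_derivative d) (at s)"
                by (intro exI[of _ "- d"]) (auto intro: DERIV_minus)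
            qed
          qed
        qed
        ultimately show "\<bar>v t' S - v t S - ham p * (t' - t)\<bar> \<le> \<eta> * (t' - t)"
          by (simp add: abs_le_iff algebra_simps)
      qed
    qed
    \<comment> \<open>So far the bound holds for almost every \<open>S\<close>; both sides are
      continuous in \<open>S\<close>, so it extends to all of \<open>U\<close>.\<close>
    have "0 \<le> \<eta> * (t' - t) - \<bar>v t' S - v t S - ham p * (t' - t)\<bar>"
    proof (rule AE_lborel_nonneg_on_open[where U = U and
          \<phi> = "\<lambda>S. \<eta> * (t' - t) - \<bar>v t' S - v t S - ham p * (t' - t)\<bar>"])
      show "continuous_on U (\<lambda>S. \<eta> * (t' - t) - \<bar>v t' S - v t S - ham p * (t' - t)\<bar>)"
        using t by (intro continuous_intros v_continuous_compose) auto
    qed (use S ae in \<open>auto simp: U_def\<close>)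
    then show ?thesis by simp
  qed
  have "\<bar>v t' S - v t S - ham p * (t' - t)\<bar> \<le> \<eta> * \<bar>t' - t\<bar>"
    if "t \<in> {0..T}" "t' \<in> {0..T}" "\<bar>t - t0\<bar> < \<delta>" "\<bar>t' - t0\<bar> < \<delta>" "\<bar>S - S0\<bar> < \<delta>" for t t' S
  proof (cases "t \<le> t'")
    case True
    then show ?thesis using inc[of t t' S] that by (auto simp: U_iff)
  next
    case False
    have "v t' S - v t S - ham p * (t' - t) = - (v t S - v t' S - ham p * (t - t'))" by (simp add: algebra_simps)
    then show ?thesis using inc[of t' t S] that False by (auto simp: U_iff)
  qed
  with \<delta>(1) show ?thesis by (rule that)
qed

text \<open>The increment splits into a time increment at the moving cash \<open>S - c * h\<close>,
  controlled by the locally uniform estimate of \<open>time_increment_near\<close>, and a cash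
  increment at fixed time \<open>t\<close>, handled by the chain rule.\<close>

lemma v_has_derivative_line:
  assumes t: "t \<in> {0<..<T}" and der: "(v t has_real_derivative p) (at (y - c * t))"
  shows "((\<lambda>s. v s (y - c * s)) has_real_derivative ham p - c * p) (at t)"
proof -
  define S where "S = y - c * t"
  have S: "(v t has_real_derivative p) (at S)" using der by (simp add: S_def)
  have shift: "y - c * (t + h) = S - c * h" for h by (simp add: S_def algebra_simps)
  have "((\<lambda>h. v t (S - c * h)) has_real_derivative p * (- c)) (at 0)"
    by (rule DERIV_chain2[of "v t" p]) (use S in \<open>auto intro!: derivative_eq_intros\<close>)
  then have space: "((\<lambda>h. (v t (S - c * h) - v t S) / h) \<longlongrightarrow> - c * p) (at 0)"
    by (simp add: DERIV_def mult.commute)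
  have time: "((\<lambda>h. (v (t + h) (S - c * h) - v t (S - c * h)) / h) \<longlongrightarrow> ham p) (at 0)"
  proof (rule LIM_I)
    fix r :: real assume r: "r > 0"
    have t': "t \<in> {0..<T}" using t by auto
    obtain \<delta> where \<delta>: "\<delta> > 0" "\<And>t1 t2 R. t1 \<in> {0..T} \<Longrightarrow> t2 \<in> {0..T} \<Longrightarrow> \<bar>t1 - t\<bar> < \<delta> \<Longrightarrow> \<bar>t2 - t\<bar> < \<delta> \<Longrightarrow>
       \<bar>R - S\<bar> < \<delta> \<Longrightarrow> \<bar>v t2 R - v t1 R - ham p * (t2 - t1)\<bar> \<le> r / 2 * \<bar>t2 - t1\<bar>"
      using time_increment_near[OF t' S, of "r / 2"] r by auto
    \<comment> \<open>Keeps \<open>t + h\<close> inside the time interval and both \<open>h\<close>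
      and \<open>c * h\<close> below \<open>\<delta>\<close>.\<close>
    define d where "d = min (min t (T - t)) (\<delta> / (1 + \<bar>c\<bar>))"
    have "norm ((v (t + h) (S - c * h) - v t (S - c * h)) / h - ham p) < r" if h: "h \<noteq> 0 \<and> norm (h - 0) < d" for h
    proof -
      have hd: "\<bar>h\<bar> < t" "\<bar>h\<bar> < T - t" "(1 + \<bar>c\<bar>) * \<bar>h\<bar> < \<delta>"
        using h by (auto simp: d_def field_simps)
      have "(1 + \<bar>c\<bar>) * \<bar>h\<bar> = \<bar>h\<bar> + \<bar>c * h\<bar>" by (simp add: abs_mult algebra_simps)
      then have h\<delta>: "\<bar>h\<bar> < \<delta>" "\<bar>c * h\<bar> < \<delta>" using hd(3) by linarith+
      have "\<bar>v (t + h) (S - c * h) - v t (S - c * h) - ham p * ((t + h) - t)\<bar> \<le> r / 2 * \<bar>(t + h) - t\<bar>"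
        by (rule \<delta>(2)) (use hd h\<delta> t \<delta>(1) in auto)
      moreover have "v (t + h) (S - c * h) - v t (S - c * h) - ham p * h
        = ((v (t + h) (S - c * h) - v t (S - c * h)) / h - ham p) * h" using h by (simp add: field_simps)
      ultimately have "\<bar>(v (t + h) (S - c * h) - v t (S - c * h)) / h - ham p\<bar> * \<bar>h\<bar> \<le> r / 2 * \<bar>h\<bar>"
        by (simp add: abs_mult)
      then show ?thesis using h r by (simp add: mult_le_cancel_right)
    qed
    moreover have "d > 0" using t \<delta>(1) by (auto simp: d_def)
    ultimately show "\<exists>s>0. \<forall>x. x \<noteq> 0 \<and> norm (x - 0) < s \<longrightarrow>
       norm ((v (t + x) (S - c * x) - v t (S - c * x)) / x - ham p) < r" by blast
  qed
  have "(v (t + h) (y - c * (t + h)) - v t (y - c * t)) / h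
     = (v (t + h) (S - c * h) - v t (S - c * h)) / h + (v t (S - c * h) - v t S) / h" for h
    unfolding shift S_def[symmetric] by (simp add: add_divide_distrib[symmetric])
  then show ?thesis
    unfolding DERIV_def using tendsto_add[OF time space] by simp
qed

text \<open>Along a trajectory of constant bid \<open>b\<close> the derivative of \<open>v\<close>
  is \<open>ham q - c * q\<close>, at least the running gain \<open>lam * F f b\<close>. The
  equation covers almost every such line, and continuity adds the others.\<close>

lemma v_dynamic_le:
  assumes t: "t \<in> {0..T}"
  shows "v t S \<le> v T (S - lam * G f b * (T - t)) - lam * F f b * (T - t)"
proof -
  define c where "c = lam * G f b"
  have "0 \<le> v T (y - c * T) - v t (y - c * t) - lam * F f b * (T - t)" for y
  proof (rule AE_lborel_nonneg_on_open[where U = UNIV and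
        \<phi> = "\<lambda>y. v T (y - c * T) - v t (y - c * t) - lam * F f b * (T - t)"])
    show "continuous_on UNIV (\<lambda>y. v T (y - c * T) - v t (y - c * t) - lam * F f b * (T - t))"
      using t by (intro continuous_intros v_continuous_compose) auto
    show "AE y in lborel. y \<in> UNIV \<longrightarrow> 0 \<le> v T (y - c * T) - v t (y - c * t) - lam * F f b * (T - t)"
      using AE_lborel_sheared_lines[OF v_equation, of c]
    proof eventually_elim
      case (elim y)
      have "lam * F f b * (T - t) \<le> v T (y - c * T) - v t (y - c * t)"
      proof (rule locally_lipschitz_AE_deriv_ge[where g = "\<lambda>s. v s (y - c * s)"])
        show "locally_lipschitz_on {t..T} (\<lambda>s. v s (y - c * s))" using t by (intro v_line_lipschitz) auto
        show "AE s in lborel. s \<in> {t<..<T} \<longrightarrow> (\<exists>d\<ge>lam * F f b. ((\<lambda>s. v s (y - c * s)) has_real_derivative d) (at s))"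
          using elim
        proof eventually_elim
          case (elim s)
          show ?case
          proof
            assume "s \<in> {t<..<T}"
            then have s: "s \<in> {0<..<T}" using t by auto
            then obtain q where "(v s has_real_derivative q) (at (y - c * s))" using elim by auto
            then have "((\<lambda>s. v s (y - c * s)) has_real_derivative ham q - c * q) (at s)"
              by (rule v_has_derivative_line[OF s])
            moreover have "lam * F f b \<le> ham q - c * q"
              using F_plus_G_le_ham[of b q] by (simp add: c_def algebra_simps)
            ultimately show "\<exists>d\<ge>lam * F f b. ((\<lambda>s. v s (y - c * s)) has_real_derivative d) (at s)" by blast
          qed
        qed
      qed (use t in auto)
      then show ?case by simp
    qed
  qed auto
  \<comment> \<open>The line through \<open>(t, S)\<close> is the one with
    \<open>y = S + c * t\<close>.\<close>
  from this[of "S + c * t"] show ?thesis by (simp add: c_def algebra_simps)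
qed

lemma v_le_V:
  assumes t: "t \<in> {0..T}"
  shows "v t S \<le> V t S"
proof -
  define b where "b = feedback (slope t S)"
  have "v t S \<le> K * (min (S - lam * G f b * (T - t)) 0)\<^sup>2 - lam * F f b * (T - t)"
    using v_dynamic_le[OF t, of S b] by (simp add: v_terminal)
  also have "\<dots> = cost T lam K f (\<lambda>_. b) t S"
  proof -
    have "(LBINT s:{t..T}. x) = (T - t) * x" for x :: real using t by (intro set_integral_const_on) auto
    then show ?thesis by (simp add: cost_def state_def mult_ac)
  qed
  also have "\<dots> = V t S" using t by (intro cost_feedback_eq_V) (auto simp: b_def)
  finally show ?thesis .
qed

text \<open>Maximum principle for \<open>V - v\<close> minus a penalty that vanishes on the cone of dependence of
  \<open>(t1, S1)\<close>. As \<open>V\<close> is smooth and \<open>v\<close> semi-concave, \<open>v\<close> has a derivative in \<open>S\<close> at the maximum.\<close>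

lemma V_le_v:
  assumes t1: "t1 \<in> {0..T}"
  shows "V t1 S1 \<le> v t1 S1"
proof (rule ccontr)
  define w where "w t S = V t S - v t S" for t S
  assume "\<not> V t1 S1 \<le> v t1 S1"
  then have w1: "w t1 S1 > 0" by (simp add: w_def)
  have wT: "w T S = 0" for S by (simp add: w_def V_terminal v_terminal)
  have t1T: "t1 < T" using t1 w1 wT[of S1] by (cases "t1 = T") auto
  define M where "M = drift_max"
  have M: "M \<ge> 0" by (simp add: M_def drift_max_nonneg)
  \<comment> \<open>The term \<open>\<epsilon> * (T - t)\<close> uses up half of
    \<open>w t1 S1\<close>, so the penalised maximum stays positive; it also provides the strict
    inequality at the end.\<close>
  define \<epsilon> where "\<epsilon> = w t1 S1 / 2 / (T - t1)"
  have \<epsilon>: "\<epsilon> > 0" "\<epsilon> * (T - t1) = w t1 S1 / 2" 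
  proof -
    have "T - t1 \<noteq> 0" using t1T by simp
    from iffD1[OF nonzero_eq_divide_eq[OF this] \<epsilon>_def] show "\<epsilon> * (T - t1) = w t1 S1 / 2" .
    show "\<epsilon> > 0" using w1 t1T by (simp add: \<epsilon>_def)
  qed
  \<comment> \<open>Radius of the cone at time \<open>T\<close> plus \<open>1\<close>, so that
    \<open>q\<close> is at least \<open>1\<close> on the lateral boundary.\<close>
  define R where "R = M * (T - t1) + 1"
  have R: "R \<ge> 1" using M t1T by (simp add: R_def)
  define D where "D = {t1..T} \<times> {S1 - R..S1 + R}"
  have "compact D" unfolding D_def by (intro compact_Times compact_Icc)
  have "(t1, S1) \<in> D" using R t1T by (auto simp: D_def)
  have w_cont: "continuous_on D (\<lambda>x. w (fst x) (snd x))"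
  proof -
    have "continuous_on ({0..T} \<times> UNIV) (\<lambda>(t, S). V t S)"
      by (rule locally_lipschitz_on_imp_continuous_on[OF V_locally_lipschitz])
    then have "continuous_on D (\<lambda>x. V (fst x) (snd x))"
      unfolding case_prod_beta by (rule continuous_on_subset) (use t1 in \<open>auto simp: D_def\<close>)
    then show ?thesis unfolding w_def using t1
      by (intro continuous_intros v_continuous_compose) (auto simp: D_def)
  qed
  obtain xm where xm: "xm \<in> D" "\<And>x. x \<in> D \<Longrightarrow> w (fst x) (snd x) \<le> w (fst xm) (snd xm)"
    using continuous_attains_sup[OF \<open>compact D\<close> _ w_cont] \<open>(t1, S1) \<in> D\<close> by blast
  \<comment> \<open>Exceeds \<open>w\<close> on all of \<open>D\<close>, so that the penalty
    excludes a maximum on the lateral boundary.\<close>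
  define B where "B = w (fst xm) (snd xm) + 1"
  have B: "B > 0" "\<And>t S. (t, S) \<in> D \<Longrightarrow> w t S < B"
    using xm(2)[OF \<open>(t1, S1) \<in> D\<close>] w1 xm(2) by (force simp: B_def)+
  \<comment> \<open>For \<open>a \<ge> 0\<close>, the squared distance of \<open>r\<close> from
    \<open>{- a..a}\<close>.\<close>
  define q where "q a r = (max 0 (\<bar>r\<bar> - a))\<^sup>2" for a r :: real
  define \<Phi> where "\<Phi> t S = w t S - \<epsilon> * (T - t) - B * q (M * (t - t1)) (S - S1)" for t S
  have "continuous_on D (\<lambda>x. \<Phi> (fst x) (snd x))"
    unfolding \<Phi>_def q_def by (intro continuous_intros w_cont)
  then obtain x0 where x0: "x0 \<in> D" "\<And>x. x \<in> D \<Longrightarrow> \<Phi> (fst x) (snd x) \<le> \<Phi> (fst x0) (snd x0)"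
    using continuous_attains_sup[OF \<open>compact D\<close>, of "\<lambda>x. \<Phi> (fst x) (snd x)"] \<open>(t1, S1) \<in> D\<close> by blast
  define t0 S0 where "t0 = fst x0" and "S0 = snd x0"
  have D0: "t0 \<in> {t1..T}" "\<bar>S0 - S1\<bar> \<le> R" using x0(1) by (auto simp: D_def t0_def S0_def)
  have max: "\<Phi> t S \<le> \<Phi> t0 S0" if "t \<in> {t1..T}" "\<bar>S - S1\<bar> \<le> R" for t S
  proof -
    have "S \<in> {S1 - R..S1 + R}" using that(2) by (auto simp: abs_le_iff)
    then show ?thesis using x0(2)[of "(t, S)"] that(1) by (simp add: D_def t0_def S0_def)
  qed
  have "\<Phi> t1 S1 > 0" using w1 \<epsilon>(2) by (simp add: \<Phi>_def q_def)
  then have \<Phi>0: "\<Phi> t0 S0 > 0" using max[of t1 S1] R t1T by auto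
  have q_nonneg: "q a r \<ge> 0" for a r by (simp add: q_def)
  have "t0 \<noteq> T"
  proof
    assume "t0 = T"
    then have "\<Phi> t0 S0 \<le> 0" using B(1) q_nonneg by (simp add: \<Phi>_def wT)
    then show False using \<Phi>0 by simp
  qed
  then have t0: "t0 \<in> {t1..<T}" "t0 \<in> {0..<T}" using D0 t1 by auto
  have "\<bar>S0 - S1\<bar> < R"
  proof (rule ccontr)
    assume "\<not> \<bar>S0 - S1\<bar> < R"
    moreover have "M * (t0 - t1) \<le> M * (T - t1)" using D0 M by (intro mult_left_mono) auto
    ultimately have "1 \<le> max 0 (\<bar>S0 - S1\<bar> - M * (t0 - t1))" by (auto simp: R_def)
    then have "1 \<le> q (M * (t0 - t1)) (S0 - S1)" unfolding q_def by (rule one_le_power)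
    then have "B \<le> B * q (M * (t0 - t1)) (S0 - S1)" using B(1) by simp
    moreover have "w t0 S0 < B" using x0(1) by (intro B(2)) (simp add: t0_def S0_def)
    moreover have "0 \<le> \<epsilon> * (T - t0)" using \<epsilon>(1) D0 by simp
    ultimately show False using \<Phi>0 by (simp add: \<Phi>_def)
  qed
  define \<rho> where "\<rho> = R - \<bar>S0 - S1\<bar>"
  have \<rho>: "\<rho> > 0" using \<open>\<bar>S0 - S1\<bar> < R\<close> by (simp add: \<rho>_def)
  define a r where "a = M * (t0 - t1)" and "r = S0 - S1"
  have a: "a \<ge> 0" using M t0 by (simp add: a_def)
  \<comment> \<open>\<open>k\<close> is \<open>r\<close> minus its projection on
    \<open>{- a..a}\<close>. Comparison with this offset bounds \<open>q\<close> above by quadratics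
    of slope \<open>2 * k\<close> in \<open>r\<close> and \<open>- 2 * \<bar>k\<bar>\<close> in
    \<open>a\<close>.\<close>
  define k where "k = r - max (- a) (min r a)"
  have k_abs: "\<bar>k\<bar> = max 0 (\<bar>r\<bar> - a)" using a by (auto simp: k_def)
  have q0: "q a r = k\<^sup>2" unfolding q_def k_abs[symmetric] by simp
  have q_space: "q a (r + z) \<le> k\<^sup>2 + 2 * k * z + z\<^sup>2" for z
  proof -
    have "max 0 (\<bar>r + z\<bar> - a) \<le> \<bar>k + z\<bar>" using a by (auto simp: k_def)
    then have "q a (r + z) \<le> \<bar>k + z\<bar>\<^sup>2" unfolding q_def by (intro power_mono) auto
    then show ?thesis by (simp add: power2_eq_square algebra_simps)
  qed
  have q_time: "q (a + y) r \<le> k\<^sup>2 - 2 * \<bar>k\<bar> * y + y\<^sup>2" if "y \<ge> 0" for y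
  proof -
    have "max 0 (\<bar>r\<bar> - (a + y)) \<le> \<bar>\<bar>k\<bar> - y\<bar>" using that k_abs by auto
    then have "q (a + y) r \<le> \<bar>\<bar>k\<bar> - y\<bar>\<^sup>2" unfolding q_def by (intro power_mono) auto
    then show ?thesis by (simp add: power2_eq_square algebra_simps)
  qed
  \<comment> \<open>Slope in \<open>S\<close> of the test function \<open>V - B * q\<close>, which
    up to a constant touches \<open>v\<close> from below.\<close>
  define p where "p = grad t0 S0 - 2 * B * k"
  define C where "C = semiconcavity * (1 + 1 / (T - t0))"
  have der: "(v t0 has_real_derivative p) (at S0)"
  proof (rule semiconcave_touched_below_DERIV[where \<phi> = "v t0" and c = C and B = B, OF _ _ \<rho>])
    show "v t0 (S0 + z) - 2 * v t0 S0 + v t0 (S0 - z) \<le> C * z\<^sup>2" for z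
      unfolding C_def by (rule v_semiconcave(2)[OF t0(2)])
    show "C \<ge> 0" using v_semiconcave(1) t0 by (simp add: C_def)
    show "B \<ge> 0" using B by simp
    fix z assume "\<bar>z\<bar> < \<rho>"
    then have "\<Phi> t0 (S0 + z) \<le> \<Phi> t0 S0" using D0 by (intro max) (auto simp: \<rho>_def)
    then have "w t0 (S0 + z) - B * q a (r + z) \<le> w t0 S0 - B * q a r"
      by (simp add: \<Phi>_def a_def r_def algebra_simps)
    moreover have "B * q a (r + z) \<le> B * (k\<^sup>2 + 2 * k * z + z\<^sup>2)" using B(1) q_space by simp
    moreover have "V t0 (S0 + z) \<ge> V t0 S0 + grad t0 S0 * z" using V_subgradient[of t0 t0 S0 "S0 + z"] t0 by simp
    ultimately show "v t0 S0 + p * z - B * z\<^sup>2 \<le> v t0 (S0 + z)"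
      by (simp add: w_def q0 p_def algebra_simps)
  qed
  obtain \<delta> where \<delta>: "\<delta> > 0"
    "\<And>t t' S. t \<in> {0..T} \<Longrightarrow> t' \<in> {0..T} \<Longrightarrow> \<bar>t - t0\<bar> < \<delta> \<Longrightarrow> \<bar>t' - t0\<bar> < \<delta> \<Longrightarrow> \<bar>S - S0\<bar> < \<delta> \<Longrightarrow>
       \<bar>v t' S - v t S - ham p * (t' - t)\<bar> \<le> \<epsilon> / 2 * \<bar>t' - t\<bar>"
    using time_increment_near[OF t0(2) der, of "\<epsilon> / 2"] \<epsilon>(1) by auto
  \<comment> \<open>A forward step, as \<open>t0\<close> may equal \<open>t1\<close>. The last bound
    keeps the quadratic part of the penalty below \<open>\<epsilon> / 4 * s\<close>.\<close>
  define s where "s = min (min (\<delta> / 2) (T - t0)) (\<epsilon> / (4 * (B * M\<^sup>2 + 1)))"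
  have BM: "B * M\<^sup>2 \<ge> 0" using B by simp
  have s: "s > 0" "s < \<delta>" "s \<le> T - t0" using \<delta>(1) t0 \<epsilon>(1) BM by (auto simp: s_def)
  have sM: "B * M\<^sup>2 * s \<le> \<epsilon> / 4"
  proof -
    have "B * M\<^sup>2 * s \<le> (B * M\<^sup>2 + 1) * s" using s(1) by (simp add: algebra_simps)
    also have "\<dots> \<le> (B * M\<^sup>2 + 1) * (\<epsilon> / (4 * (B * M\<^sup>2 + 1)))" using BM by (intro mult_left_mono) (auto simp: s_def)
    also have "\<dots> = \<epsilon> / 4" using BM by (simp add: field_simps)
    finally show ?thesis .
  qed
  have "\<Phi> (t0 + s) S0 \<le> \<Phi> t0 S0" using D0 s by (intro max) auto
  moreover have "M * (t0 + s - t1) = a + M * s" by (simp add: a_def algebra_simps)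
  ultimately have 1: "w (t0 + s) S0 + \<epsilon> * s - B * q (a + M * s) r \<le> w t0 S0 - B * q a r"
    by (simp add: \<Phi>_def a_def[symmetric] r_def[symmetric] algebra_simps)
  have 2: "V (t0 + s) S0 \<ge> V t0 S0 + ham (grad t0 S0) * s" using V_subgradient[of "t0 + s" t0 S0 S0] s by simp
  have "\<bar>v (t0 + s) S0 - v t0 S0 - ham p * (t0 + s - t0)\<bar> \<le> \<epsilon> / 2 * \<bar>t0 + s - t0\<bar>"
    by (rule \<delta>(2)) (use s t0 \<delta>(1) in auto)
  from abs_le_D1[OF this] have 3: "v (t0 + s) S0 \<le> v t0 S0 + ham p * s + \<epsilon> / 2 * s" using s(1) by simp
  have 4: "B * q (a + M * s) r \<le> B * (k\<^sup>2 - 2 * \<bar>k\<bar> * (M * s) + (M * s)\<^sup>2)"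
    using B(1) q_time[of "M * s"] M s(1) by simp
  \<comment> \<open>The cone widens at speed \<open>M\<close>, a Lipschitz constant of
    \<open>ham\<close>, so the decrease of the penalty in time pays for replacing
    \<open>grad t0 S0\<close> by \<open>p\<close> in the Hamiltonian.\<close>
  have "ham p - ham (grad t0 S0) \<le> M * (2 * B * \<bar>k\<bar>)"
    using ham_diff_le[of p "grad t0 S0"] B(1) by (simp add: p_def M_def abs_mult)
  then have 5: "(ham p - ham (grad t0 S0)) * s \<le> M * (2 * B * \<bar>k\<bar>) * s" using s(1) by (intro mult_right_mono) auto
  have 6: "B * M\<^sup>2 * s * s \<le> \<epsilon> / 4 * s" using sM s(1) by (intro mult_right_mono) auto
  have "\<epsilon> * s \<le> \<epsilon> / 2 * s + \<epsilon> / 4 * s"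
    using 1 2 3 4 5 6 by (simp add: w_def q0 algebra_simps power2_eq_square)
  moreover have "\<epsilon> * s > 0" using \<epsilon>(1) s(1) by simp
  ultimately show False by simp
qed

lemma v_eq_value_fun: "t \<in> {0..T} \<Longrightarrow> v t S = value_fun T lam K f t S"
  using v_le_V V_le_v by (simp add: value_fun_eq_V antisym)

end

theorem mainTheorem1:
  fixes T lam K :: real and f :: "real \<Rightarrow> real"
  assumes "T > 0" and "lam > 0" and "K > 0"
    and "set_integrable lborel {0<..} f"
    and "(LBINT p:{0<..}. f p) = 1"
    and "\<And>p. p > 0 \<Longrightarrow> f p > 0"
    and "((\<lambda>p. p ^ 3 * f p) \<longlongrightarrow> 0) at_top"
  shows
    "(\<forall>x. H lam f x =
        (if x < 0 then - lam * x * (LBINT p:{0..- 1 / x}. F f (ennreal p))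
         else lam * (1 + x * (LBINT p:{0<..}. p * f p)))) \<and>
     (\<forall>t\<in>{0..T}. \<forall>S.
        value_fun T lam K f t S =
          (SUP x\<in>{..0}. S * x - (T - t) * H lam f x - x\<^sup>2 / (4 * K))) \<and>
     weak_semiconcave_solution T lam K f (value_fun T lam K f) \<and>
     (\<forall>v. weak_semiconcave_solution T lam K f v \<longrightarrow>
        (\<forall>t\<in>{0..T}. \<forall>S. v t S = value_fun T lam K f t S)) \<and>
     (\<forall>x. H lam f differentiable (at x)) \<and>
     (\<exists>bs. optimal_control_function T lam K f bs \<and>
        (\<forall>t\<in>{0..T}. \<forall>S.
           (S \<ge> lam * (T - t) * (LBINT p:{0<..}. p * f p) \<longrightarrow> bs t S = \<infinity>) \<and>
           (S < lam * (T - t) * (LBINT p:{0<..}. p * f p) \<longrightarrow>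
              (\<exists>x<0. bs t S = ennreal (- 1 / x) \<and>
                 (\<forall>y. S = (T - t) * deriv (H lam f) y + y / (2 * K) \<longleftrightarrow> y = x)))))"
proof -
  interpret bidding T lam K f
    using assms by unfold_locales
  have H: "H lam f = ham" by (rule ext) (rule H_eq_ham)
  have drift: "deriv (H lam f) y = drift y" for y
    unfolding H by (rule DERIV_imp_deriv[OF ham_has_derivative])
  have zero: "slope t S < 0 \<longleftrightarrow> S < lam * (T - t) * (LBINT p:{0<..}. p * f p)" if "t \<in> {0..T}" for t S
    using slope_neg_iff[of t S] that by (simp add: drift_max_def mult_ac)
  \<comment> \<open>A negative root is not clipped and is the only solution among all real
    \<open>y\<close>.\<close>
  have x_star: "(\<exists>x<0. feedback (slope t S) = ennreal (- 1 / x) \<and>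
      (\<forall>y. S = (T - t) * deriv (H lam f) y + y / (2 * K) \<longleftrightarrow> y = x))"
    if "t \<in> {0..T}" "slope t S < 0" for t S
    using that slope_eq[of t S] slope_unique[of t S]
    by (intro exI[of _ "slope t S"]) (auto simp: drift feedback_def)
  have unique: "v t S = value_fun T lam K f t S"
    if "weak_semiconcave_solution T lam K f v" "t \<in> {0..T}" for v t S
  proof -
    interpret bidding_solution T lam K f v
      using that(1) by unfold_locales
    show ?thesis by (rule v_eq_value_fun[OF that(2)])
  qed
  show ?thesis
  proof (intro conjI)
    show "\<forall>x. H lam f x =
        (if x < 0 then - lam * x * (LBINT p:{0..- 1 / x}. F f (ennreal p))
         else lam * (1 + x * (LBINT p:{0<..}. p * f p)))"
      unfolding H using ham_neg_arg ham_nonneg_arg by simp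
    show "\<forall>t\<in>{0..T}. \<forall>S.
        value_fun T lam K f t S = (SUP x\<in>{..0}. S * x - (T - t) * H lam f x - x\<^sup>2 / (4 * K))"
      unfolding H by (simp add: value_fun_eq_V V_eq_SUP)
    show "\<forall>x. H lam f differentiable (at x)"
      unfolding H using ham_has_derivative real_differentiable_def by blast
    show "\<exists>bs. optimal_control_function T lam K f bs \<and>
        (\<forall>t\<in>{0..T}. \<forall>S.
           (S \<ge> lam * (T - t) * (LBINT p:{0<..}. p * f p) \<longrightarrow> bs t S = \<infinity>) \<and>
           (S < lam * (T - t) * (LBINT p:{0<..}. p * f p) \<longrightarrow>
              (\<exists>x<0. bs t S = ennreal (- 1 / x) \<and>
                 (\<forall>y. S = (T - t) * deriv (H lam f) y + y / (2 * K) \<longleftrightarrow> y = x))))"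
    proof (intro exI[of _ "\<lambda>t S. feedback (slope t S)"] conjI ballI allI impI)
      fix t S assume t: "t \<in> {0..T}"
      show "feedback (slope t S) = \<infinity>" if "S \<ge> lam * (T - t) * (LBINT p:{0<..}. p * f p)"
        using zero[OF t, of S] that by (simp add: feedback_def)
      show "\<exists>x<0. feedback (slope t S) = ennreal (- 1 / x) \<and>
                 (\<forall>y. S = (T - t) * deriv (H lam f) y + y / (2 * K) \<longleftrightarrow> y = x)"
        if "S < lam * (T - t) * (LBINT p:{0<..}. p * f p)"
        using zero[OF t, of S] that x_star[OF t] by blast
    qed (rule feedback_optimal)
  qed (use unique V_weak_semiconcave_solution in blast)+
qed

end
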